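(* Let $1 \leq j \leq N$ and let $\sigma \in \mathbb{S}^{N-1}$ be such that $\sigma_j \neq 0$. Then, $$\frac{\Gamma(\frac{N}{2})}{2\pi^{\frac{N}{2}}}(1 - N\sigma_1^2) = \frac{i^N}{(2\pi\sigma_j)^N}\bigg( \frac{i}{\sigma_j}\int_{B(0,1)^c} \partial_j^{N+1}\widehat{R_{1,1}}(\xi)\, e^{i\sigma\cdot\xi}\,d\xi + \frac{i}{\sigma_j}\int_{\mathbb{S}^{N-1}} \xi_j\, \partial_j^N\widehat{R_{1,1}}(\xi)\, e^{i\sigma\cdot\xi}\,d\xi + \int_{\mathbb{S}^{N-1}} \xi_j\, \partial_j^{N-1}\widehat{R_{1,1}}(\xi)\,d\xi + \int_{B(0,1)} \partial_j^N\widehat{R_{1,1}}(\xi)\,(e^{i\sigma\cdot\xi}-1)\,d\xi \bigg).$$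
   Context: $N \geq 2$ is an integer; $B(0,1)$ is the unit ball of $\mathbb{R}^N$, $B(0,1)^c$ its complement, and integrals over $\mathbb{S}^{N-1}$ are with respect to surface measure. $\widehat{R_{1,1}}$ is the Fourier transform of the composed Riesz kernel $R_{1,1}$, namely the function $$\widehat{R_{1,1}}(\xi) = \frac{\xi_1^2}{|\xi|^2}, \qquad \xi \in \mathbb{R}^N\setminus\{0\},$$ and its partial derivatives are the classical ones on $\mathbb{R}^N \setminus \{0\}$. *)

theory Defs
  imports "HOL-Analysis.Analysis"
begin

text \<open>
  The surface measure of the unit sphere in polar coordinates: the measure of a Borel set
  \<open>A\<close> is the dimension times the volume of the cone \<open>{r x | 0 < r < 1, x \<in> A}\<close>.
  The space of this measure is the sphere itself, so an integral with respect to it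
  is an integral over the sphere.
\<close>

definition sphere_measure :: "'a::euclidean_space measure" where
  "sphere_measure =
     scale_measure (ennreal (real DIM('a)))
       (distr (restrict_space lborel (ball 0 1 - {0})) (restrict_space borel (sphere 0 1))
          (\<lambda>x. x /\<^sub>R norm x))"

lemma space_sphere_measure: "space (sphere_measure :: 'a::euclidean_space measure) = sphere 0 1"
  by (simp add: sphere_measure_def space_scale_measure space_restrict_space)

lemma measurable_radial_projection:
  "(\<lambda>x::'a::euclidean_space. x /\<^sub>R norm x) \<in>
     restrict_space lborel (ball 0 1 - {0}) \<rightarrow>\<^sub>M restrict_space borel (sphere 0 1)"
proof (rule measurable_restrict_space2)
  show "(\<lambda>x::'a. x /\<^sub>R norm x) \<in> space (restrict_space lborel (ball 0 1 - {0})) \<rightarrow> sphere 0 1"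
    by (auto simp: space_restrict_space)
  show "(\<lambda>x::'a. x /\<^sub>R norm x) \<in> restrict_space lborel (ball 0 1 - {0}) \<rightarrow>\<^sub>M borel"
    by (rule measurable_restrict_space1) measurable
qed

lemma emeasure_sphere_measure:
  fixes A :: "'a::euclidean_space set"
  assumes "A \<in> sets borel" "A \<subseteq> sphere 0 1"
  shows "emeasure sphere_measure A =
    ennreal (real DIM('a)) * emeasure lborel {x \<in> ball 0 1 - {0}. x /\<^sub>R norm x \<in> A}"
proof -
  have A: "A \<in> sets (restrict_space borel (sphere 0 1))"
    using assms by (subst sets_restrict_space_iff) auto
  let ?p = "\<lambda>x::'a. x /\<^sub>R norm x" and ?B = "ball (0::'a) 1 - {0}"
  have "emeasure (distr (restrict_space lborel ?B) (restrict_space borel (sphere 0 1)) ?p) A =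
      emeasure (restrict_space lborel ?B) (?p -` A \<inter> space (restrict_space lborel ?B))"
    by (rule emeasure_distr[OF measurable_radial_projection A])
  also have "?p -` A \<inter> space (restrict_space lborel ?B) = {x \<in> ?B. ?p x \<in> A}"
    by (auto simp: space_restrict_space)
  also have "emeasure (restrict_space lborel ?B) \<dots> = emeasure lborel {x \<in> ?B. ?p x \<in> A}"
    by (rule emeasure_restrict_space) auto
  finally show ?thesis
    by (simp add: sphere_measure_def)
qed

lemma emeasure_sphere_measure_sphere:
  "emeasure sphere_measure (sphere 0 1 :: 'a::euclidean_space set) =
    ennreal (2 * pi powr (real DIM('a) / 2) / Gamma (real DIM('a) / 2))"
proof -
  let ?n = "real DIM('a)"
  have n: "?n > 0" by simp
  have "{x \<in> ball 0 1 - {0}. x /\<^sub>R norm x \<in> sphere 0 1} = ball (0::'a) 1 - {0}"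
    by auto
  then have "emeasure sphere_measure (sphere 0 1 :: 'a set) =
      ennreal ?n * emeasure lborel (ball (0::'a) 1 - {0})"
    by (subst emeasure_sphere_measure) auto
  also have "emeasure lborel (ball (0::'a) 1 - {0}) = emeasure lborel (ball (0::'a) 1)"
    by (rule emeasure_Diff_null_set) (auto simp: null_sets_def)
  also have "\<dots> = ennreal (unit_ball_vol ?n)"
    by (simp add: emeasure_ball)
  also have "ennreal ?n * \<dots> = ennreal (?n * unit_ball_vol ?n)"
    by (simp add: ennreal_mult)
  also have "?n * unit_ball_vol ?n = 2 * pi powr (?n / 2) / Gamma (?n / 2)"
  proof -
    have *: "Gamma (?n / 2 + 1) = ?n / 2 * Gamma (?n / 2)"
      using Gamma_plus1[of "?n / 2"] n nonpos_Ints_nonpos[of "?n / 2"] by fastforce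
    show ?thesis
      unfolding unit_ball_vol_def * by simp
  qed
  finally show ?thesis .
qed

definition partial_deriv :: "'n::finite \<Rightarrow> (real^'n \<Rightarrow> real) \<Rightarrow> real^'n \<Rightarrow> real" where
  "partial_deriv j f x = deriv (\<lambda>t. f (x + t *\<^sub>R axis j 1)) 0"

text \<open>
  Fourier transform of the composed Riesz kernel in the direction \<open>k\<close>. The value at the
  origin, where the symbol is undefined, is \<open>0\<close> by the convention for division; it affects
  none of the derivatives away from the origin.
\<close>

definition riesz_hat :: "'n::finite \<Rightarrow> real^'n \<Rightarrow> real" where
  "riesz_hat k \<xi> = (\<xi> $ k)\<^sup>2 / (norm \<xi>)\<^sup>2"

end

theory Submission
  imports Defs "HOL-Probability.Characteristic_Functions"
begin

text \<open>
  Write \<open>m(\<xi>) = \<xi>\<^sub>i\<^sup>2 / |\<xi>|\<^sup>2\<close> for the symbol, \<open>i\<close> being the distinguished direction. The bracket on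
  the right-hand side is a linear functional \<open>L(m)\<close> of the symbol; it is the value at \<open>\<sigma>\<close> of the
  Fourier transform of the distribution \<open>\<partial>\<^sub>j\<^sup>N m\<close>, rewritten so that only absolutely convergent
  integrals occur. The proof replaces distributions by a superposition of Gaussians:
  \<open>m = \<integral>\<^sub>0\<^sup>\<infinity> g\<^sub>t dt\<close> with \<open>g\<^sub>t(\<xi>) = \<xi>\<^sub>i\<^sup>2 exp (-t|\<xi>|\<^sup>2)\<close>.

  For a single \<open>t > 0\<close> the function \<open>g\<^sub>t\<close> decays rapidly and the four terms collapse. The divergence
  theorem on the unit ball and on its complement (\<open>divergence_ball\<close>) undoes the two integrations by
  parts that produced the sphere terms, so that \<open>L(g\<^sub>t)\<close> is the integral of
  \<open>\<partial>\<^sub>j\<^sup>N g\<^sub>t(\<xi>) exp (i\<sigma>\<cdot>\<xi>)\<close> over the whole space (\<open>regularized_boundary_terms\<close>). Moving the \<open>N\<close>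
  derivatives onto the exponential yields the factor \<open>(-i\<sigma>\<^sub>j)\<^sup>N\<close> (\<open>integral_gauss_deriv_wave\<close>) and
  leaves the Fourier transform of \<open>g\<^sub>t\<close>, which is explicit (\<open>integral_gaussian_sqr_iexp\<close>).

  Integration over \<open>t\<close> commutes with each of the four integrals, because
  \<open>\<integral>\<^sub>0\<^sup>\<infinity> |\<partial>\<^sub>j\<^sup>k g\<^sub>t(\<xi>)| dt \<le> C |\<xi>|\<^sup>-\<^sup>k\<close>: outside the ball the order is \<open>k = N + 1\<close>, inside it is \<open>k = N\<close>
  and the factor \<open>exp (i\<sigma>\<cdot>\<xi>) - 1 = O(|\<xi>|)\<close> gains one power, and on the sphere \<open>|\<xi>| = 1\<close>. Hence
  \<open>L(m) = \<integral>\<^sub>0\<^sup>\<infinity> L(g\<^sub>t) dt\<close> (\<open>riesz_boundary_terms\<close>). The remaining integral over \<open>t\<close> turns into values of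
  the Gamma function under \<open>t = 1/(4s)\<close> (\<open>integral_gaussian_profile\<close>), and \<open>\<Gamma>(N/2 + 1) = (N/2) \<Gamma>(N/2)\<close>
  produces the factor \<open>1 - N\<sigma>\<^sub>i\<^sup>2\<close>.
\<close>

section \<open>Integrals of directional derivatives\<close>

lemma
  fixes F :: "'a::euclidean_space \<Rightarrow> 'b::{banach, second_countable_topology}"
  shows lborel_integral_translation: "(\<integral>x. F (c + x) \<partial>lborel) = integral\<^sup>L lborel F"
    and lborel_integrable_translation: "integrable lborel (\<lambda>x. F (c + x)) \<longleftrightarrow> integrable lborel F"
proof -
  have *: "integrable lborel (\<lambda>x. G (d + x))" if "integrable lborel G"
    for G :: "'a \<Rightarrow> 'b" and d
    by (rule integrable_distr[where T = "(+) d" and M' = borel]) (use that in \<open>auto simp: lborel_distr_plus\<close>)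
  show iff: "integrable lborel (\<lambda>x. F (c + x)) \<longleftrightarrow> integrable lborel F"
    using *[of F c] *[of "\<lambda>x. F (c + x)" "- c"] by (auto simp flip: add.assoc)
  show "(\<integral>x. F (c + x) \<partial>lborel) = integral\<^sup>L lborel F"
  proof (cases "integrable lborel F")
    case True
    then have [measurable]: "F \<in> borel_measurable borel"
      by auto
    have "integral\<^sup>L (distr lborel borel ((+) c)) F = (\<integral>x. F (c + x) \<partial>lborel)"
      by (subst integral_distr) auto
    then show ?thesis
      by (simp add: lborel_distr_plus)
  next
    case False
    with iff show ?thesis
      by (simp add: not_integrable_integral_eq)
  qed
qed

text \<open>
  Translation invariance gives \<open>\<integral>F(x + e) - F(x) dx = 0\<close>, while by the fundamental theorem of
  calculus on each line and by Fubini this integral is \<open>\<integral>\<^sub>0\<^sup>1 \<integral>D(x + s e) dx ds = \<integral>D\<close>. The exceptional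
  set \<open>E\<close> admits functions with kinks, such as the cutoffs of the divergence theorem.
\<close>

lemma integral_directional_derivative_eq_0:
  fixes F D :: "'a::euclidean_space \<Rightarrow> 'b::euclidean_space"
  assumes F: "integrable lborel F" and D: "integrable lborel D"
    and cont: "\<And>x. continuous_on {0..1} (\<lambda>s. F (x + s *\<^sub>R e))"
    and fin: "\<And>x. finite {s. x + s *\<^sub>R e \<in> E}"
    and der: "\<And>x s. x + s *\<^sub>R e \<notin> E \<Longrightarrow>
      ((\<lambda>s. F (x + s *\<^sub>R e)) has_vector_derivative D (x + s *\<^sub>R e)) (at s)"
  shows "integral\<^sup>L lborel D = 0"
proof -
  have [measurable]: "F \<in> borel_measurable borel" "D \<in> borel_measurable borel"
    using F D by auto
  define H where "H s x = indicator {0..1::real} s *\<^sub>R D (x + s *\<^sub>R e)" for s x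
  have Hm [measurable]: "case_prod H \<in> borel_measurable (lborel \<Otimes>\<^sub>M lborel)"
    unfolding H_def by measurable
  have tr: "integrable lborel (\<lambda>x. D (x + c))" "(\<integral>x. D (x + c) \<partial>lborel) = integral\<^sup>L lborel D" for c
    using lborel_integral_translation[of D c] lborel_integrable_translation[of D c] D
    by (simp_all add: add.commute)
  have trn: "(\<integral>x. norm (D (x + c)) \<partial>lborel) = (\<integral>x. norm (D x) \<partial>lborel)" for c
    using lborel_integral_translation[of "\<lambda>x. norm (D x)" c] by (simp_all add: add.commute)
  have int: "integrable (lborel \<Otimes>\<^sub>M lborel) (case_prod H)"
  proof (rule lborel_pair.Fubini_integrable[OF Hm])
    have "(\<integral>x. norm (H s x) \<partial>lborel) = indicator {0..1} s *\<^sub>R (\<integral>x. norm (D x) \<partial>lborel)" for s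
      by (simp add: H_def trn)
    then show "integrable lborel (\<lambda>s. \<integral>x. norm (case (s, x) of (s, x) \<Rightarrow> H s x) \<partial>lborel)"
      by simp
    show "AE s in lborel. integrable lborel (\<lambda>x. case (s, x) of (s, x) \<Rightarrow> H s x)"
      by (auto simp: H_def intro!: tr(1))
  qed
  have "integral\<^sup>L lborel D = (\<integral>s. \<integral>x. H s x \<partial>lborel \<partial>lborel)"
    by (simp add: H_def tr)
  also have "\<dots> = (\<integral>x. \<integral>s. H s x \<partial>lborel \<partial>lborel)"
    by (rule lborel_pair.Fubini_integral[OF int, symmetric])
  also have "\<dots> = (\<integral>x. F (x + e) - F x \<partial>lborel)"
  proof (rule integral_cong_AE)
    show "AE x in lborel. (\<integral>s. H s x \<partial>lborel) = F (x + e) - F x"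
      using lborel_pair.AE_integrable_snd[OF int]
    proof eventually_elim
      case (elim x)
      have "((\<lambda>s. D (x + s *\<^sub>R e)) has_integral F (x + 1 *\<^sub>R e) - F (x + 0 *\<^sub>R e)) {0..1}"
        by (rule fundamental_theorem_of_calculus_strong[OF fin[of x]]) (auto intro: cont der)
      moreover have "set_integrable lborel {0..1} (\<lambda>s. D (x + s *\<^sub>R e))"
        using elim by (simp add: set_integrable_def H_def)
      ultimately show ?case
        using set_borel_integral_eq_integral(2)[of "{0..1}" "\<lambda>s. D (x + s *\<^sub>R e)"]
        by (simp add: H_def set_lebesgue_integral_def integral_unique)
    qed
  qed measurable
  also have "\<dots> = 0"
    using lborel_integral_translation[of F e] lborel_integrable_translation[of F e] F
    by (subst Bochner_Integration.integral_diff) (simp_all add: add.commute)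
  finally show ?thesis .
qed

lemma finite_line_meets_sphere:
  fixes e :: "'a::real_inner"
  assumes "e \<noteq> 0"
  shows "finite {s. norm (x + s *\<^sub>R e) = r}"
proof -
  have "poly [:x \<bullet> x - r^2, 2 * (x \<bullet> e), e \<bullet> e:] s = 0" if "norm (x + s *\<^sub>R e) = r" for s
  proof -
    have "(norm (x + s *\<^sub>R e))\<^sup>2 = r\<^sup>2"
      using that by simp
    then show ?thesis
      by (simp add: power2_norm_eq_inner inner_simps algebra_simps inner_commute)
  qed
  then have "{s. norm (x + s *\<^sub>R e) = r} \<subseteq> {s. poly [:x \<bullet> x - r^2, 2 * (x \<bullet> e), e \<bullet> e:] s = 0}"
    by auto
  moreover have "finite {s. poly [:x \<bullet> x - r^2, 2 * (x \<bullet> e), e \<bullet> e:] s = 0}"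
    using assms by (intro poly_roots_finite) auto
  ultimately show ?thesis
    by (rule finite_subset)
qed

section \<open>The divergence theorem on the unit ball\<close>

lemma sets_sphere_measure [measurable_cong]:
  "sets (sphere_measure :: 'a::euclidean_space measure) = sets (restrict_space borel (sphere 0 1))"
  by (simp add: sphere_measure_def)

lemma finite_measure_sphere_measure:
  "finite_measure (sphere_measure :: 'a::euclidean_space measure)"
  by (rule finite_measureI) (simp add: space_sphere_measure emeasure_sphere_measure_sphere)

lemma borel_measurable_sphere_measure:
  "f \<in> borel_measurable borel \<Longrightarrow> f \<in> borel_measurable (sphere_measure :: 'a::euclidean_space measure)"
  by (subst measurable_cong_sets[OF sets_sphere_measure refl]) (rule measurable_restrict_space1)

lemma borel_measurable_radial_extension:
  fixes g :: "'a::euclidean_space \<Rightarrow> 'b::topological_space"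
  assumes "g \<in> borel_measurable borel"
  shows "(\<lambda>x. g (x /\<^sub>R norm x)) \<in> borel_measurable borel"
  by (rule measurable_compose[OF _ assms]) measurable

text \<open>
  The cone construction of the surface measure turns an integral over the sphere into a volume
  integral of the extension that is constant on rays. This formula takes the place of polar
  coordinates in the proof of the divergence theorem.
\<close>

lemma integral_sphere_measure:
  fixes g :: "'a::euclidean_space \<Rightarrow> 'b::{banach, second_countable_topology}"
  assumes [measurable]: "g \<in> borel_measurable borel"
  shows "(\<integral>x. g x \<partial>sphere_measure) =
    real DIM('a) *\<^sub>R (\<integral>x. indicator (ball 0 1) x *\<^sub>R g (x /\<^sub>R norm x) \<partial>lborel)"
proof -
  note [measurable] = borel_measurable_radial_extension[OF assms]
  let ?P = "distr (restrict_space lborel (ball 0 1 - {0})) (restrict_space borel (sphere 0 1))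
          (\<lambda>x::'a. x /\<^sub>R norm x)"
  have "sphere_measure = density ?P (\<lambda>_. ennreal (real DIM('a)))"
    unfolding sphere_measure_def
    by (rule measure_eqI) (auto simp: emeasure_density nn_integral_cmult nn_integral_cmult_indicator)
  moreover have "g \<in> borel_measurable ?P"
    by (simp add: measurable_restrict_space1)
  ultimately have "(\<integral>x. g x \<partial>sphere_measure) = (\<integral>x. real DIM('a) *\<^sub>R g x \<partial>?P)"
    using integral_density[of g ?P "\<lambda>_. real DIM('a)"] by simp
  also have "\<dots> = real DIM('a) *\<^sub>R (\<integral>x. g x \<partial>?P)"
    by simp
  also have "(\<integral>x. g x \<partial>?P) = (\<integral>x. g (x /\<^sub>R norm x) \<partial>restrict_space lborel (ball 0 1 - {0}))"
    by (rule integral_distr) (auto simp: measurable_radial_projection measurable_restrict_space1)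
  also have "\<dots> = (\<integral>x. indicator (ball 0 1 - {0}) x *\<^sub>R g (x /\<^sub>R norm x) \<partial>lborel)"
    by (subst integral_restrict_space) (auto simp: set_lebesgue_integral_def)
  also have "\<dots> = (\<integral>x. indicator (ball 0 1) x *\<^sub>R g (x /\<^sub>R norm x) \<partial>lborel)"
  proof (rule integral_cong_AE)
    show "AE x in lborel. indicator (ball 0 1 - {0}) x *\<^sub>R g (x /\<^sub>R norm x) =
      indicator (ball 0 1) x *\<^sub>R g (x /\<^sub>R norm x)"
      using AE_lborel_singleton[of 0] by eventually_elim (auto simp: indicator_def)
  qed (intro borel_measurable_scaleR borel_measurable_indicator; auto)+
  finally show ?thesis .
qed

text \<open>
  Dilation by \<open>r\<close> fixes functions that are constant on rays and multiplies volume by the \<open>N\<close>-th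
  power of \<open>r\<close>, where \<open>N\<close> is the dimension.
\<close>

lemma integral_cone_scale:
  fixes g :: "'a::euclidean_space \<Rightarrow> 'b::{banach, second_countable_topology}"
  assumes [measurable]: "g \<in> borel_measurable borel" and r: "0 < r"
  shows "(\<integral>x. indicator (ball 0 r) x *\<^sub>R g (x /\<^sub>R norm x) \<partial>lborel) =
    r ^ DIM('a) *\<^sub>R (\<integral>x. indicator (ball 0 1) x *\<^sub>R g (x /\<^sub>R norm x) \<partial>lborel)"
proof -
  have [measurable]: "(\<lambda>x. indicator (ball 0 r) x *\<^sub>R g (x /\<^sub>R norm x)) \<in> borel_measurable borel"
    by (intro borel_measurable_scaleR borel_measurable_indicator borel_measurable_radial_extension assms) auto
  have "(\<integral>x. indicator (ball 0 r) x *\<^sub>R g (x /\<^sub>R norm x) \<partial>lborel) =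
    (\<integral>x. indicator (ball 0 r) x *\<^sub>R g (x /\<^sub>R norm x)
       \<partial>density (distr lborel borel (\<lambda>x::'a. 0 + r *\<^sub>R x)) (\<lambda>_. ennreal (\<bar>r\<bar>^DIM('a))))"
    using r by (subst lborel_affine[of r 0]) simp_all
  also have "\<dots> = (\<integral>x. r ^ DIM('a) *\<^sub>R (indicator (ball 0 r) x *\<^sub>R g (x /\<^sub>R norm x))
       \<partial>distr lborel borel (\<lambda>x::'a. r *\<^sub>R x))"
    using r by (subst integral_density) simp_all
  also have "\<dots> = r ^ DIM('a) *\<^sub>R (\<integral>x. indicator (ball 0 r) x *\<^sub>R g (x /\<^sub>R norm x)
       \<partial>distr lborel borel (\<lambda>x::'a. r *\<^sub>R x))"
    by (rule integral_scaleR_right)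
  also have "(\<integral>x. indicator (ball 0 r) x *\<^sub>R g (x /\<^sub>R norm x) \<partial>distr lborel borel (\<lambda>x::'a. r *\<^sub>R x)) =
     (\<integral>x. indicator (ball 0 r) (r *\<^sub>R x) *\<^sub>R g ((r *\<^sub>R x) /\<^sub>R norm (r *\<^sub>R x)) \<partial>lborel)"
    by (rule integral_distr) auto
  also have "(\<lambda>x::'a. indicator (ball 0 r) (r *\<^sub>R x) *\<^sub>R g ((r *\<^sub>R x) /\<^sub>R norm (r *\<^sub>R x))) =
     (\<lambda>x. indicator (ball 0 1) x *\<^sub>R g (x /\<^sub>R norm x))"
    using r by (intro ext) (auto simp: indicator_def mult.assoc field_simps)
  finally show ?thesis .
qed

text \<open>
  A Lipschitz approximation of the indicator function of the unit ball; its gradient lives on the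
  layer \<open>1 - h < |x| < 1\<close>, which shrinks to the sphere as \<open>h \<rightarrow> 0\<close>.
\<close>

definition radial_cutoff :: "real \<Rightarrow> 'a::real_normed_vector \<Rightarrow> real" where
  "radial_cutoff h x = max 0 (min 1 ((1 - norm x) / h))"

lemma has_real_derivative_norm_line:
  fixes x e :: "'a::real_inner"
  assumes "x + s *\<^sub>R e \<noteq> 0"
  shows "((\<lambda>s. norm (x + s *\<^sub>R e)) has_real_derivative
    ((x + s *\<^sub>R e) \<bullet> e) / norm (x + s *\<^sub>R e)) (at s)"
proof -
  have "((\<lambda>s. x + s *\<^sub>R e) has_derivative (\<lambda>t. t *\<^sub>R e)) (at s)"
    by (auto intro!: derivative_eq_intros)
  from has_derivative_compose[OF this has_derivative_norm[OF assms]]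
  have "((\<lambda>s. norm (x + s *\<^sub>R e)) has_derivative (\<lambda>t. (t *\<^sub>R e) \<bullet> sgn (x + s *\<^sub>R e))) (at s)"
    by (simp add: inner_commute)
  then show ?thesis
    by (simp add: has_field_derivative_def sgn_div_norm inner_commute divide_inverse mult_ac
        mult_commute_abs)
qed

lemma radial_cutoff_derivative:
  fixes x e :: "'a::real_inner"
  assumes h: "0 < h" "h < 1" and y: "x + s *\<^sub>R e \<notin> {y. norm y = 1 \<or> norm y = 1 - h}"
  shows "((\<lambda>s. radial_cutoff h (x + s *\<^sub>R e)) has_real_derivative
    - indicator {y. 1 - h < norm y \<and> norm y < 1} (x + s *\<^sub>R e) *
    (((x + s *\<^sub>R e) \<bullet> e) / norm (x + s *\<^sub>R e)) / h) (at s)"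
proof -
  let ?y = "\<lambda>s. x + s *\<^sub>R e"
  have opn: "open (?y -` U)" if "open U" for U
    by (rule open_vimage[OF that]) (intro continuous_intros)
  have o1: "open {y::'a. norm y < r}" and o2: "open {y::'a. r < norm y}" for r
    by (auto intro!: open_Collect_less continuous_intros)
  \<comment> \<open>On each of the three open regions the cutoff is given by one smooth formula.\<close>
  consider "norm (?y s) < 1 - h" | "1 < norm (?y s)" | "1 - h < norm (?y s)" "norm (?y s) < 1"
    using y by force
  then show ?thesis
  proof cases
    case 1
    have "((\<lambda>_. 1) has_real_derivative 0) (at s)"
      by simp
    then have "((\<lambda>s. radial_cutoff h (?y s)) has_real_derivative 0) (at s)"
      by (rule has_field_derivative_transform_within_open[OF _ opn[OF o1[of "1 - h"]]])
        (use 1 h in \<open>auto simp: radial_cutoff_def min_def field_simps\<close>)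
    with 1 show ?thesis by simp
  next
    case 2
    have "((\<lambda>_. 0) has_real_derivative 0) (at s)"
      by simp
    then have "((\<lambda>s. radial_cutoff h (?y s)) has_real_derivative 0) (at s)"
      by (rule has_field_derivative_transform_within_open[OF _ opn[OF o2[of 1]]])
        (use 2 h in \<open>auto simp: radial_cutoff_def max_def min_def field_simps\<close>)
    with 2 show ?thesis by simp
  next
    case 3
    have "((\<lambda>s. (1 - norm (?y s)) / h) has_real_derivative - ((?y s \<bullet> e) / norm (?y s)) / h) (at s)"
      by (rule derivative_eq_intros has_real_derivative_norm_line refl | use 3 h in force)+
    then have "((\<lambda>s. radial_cutoff h (?y s)) has_real_derivative - ((?y s \<bullet> e) / norm (?y s)) / h) (at s)"
      by (rule has_field_derivative_transform_within_open[OF _ opn[OF open_Int[OF o1[of 1] o2[of "1 - h"]]]])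
        (use 3 h in \<open>auto simp: radial_cutoff_def max_def min_def field_simps\<close>)
    with 3 show ?thesis by simp
  qed
qed

text \<open>
  The product of \<open>F\<close> with the cutoff has compact support and is differentiable on each line except
  where the line meets the two spheres \<open>|x| = 1 - h\<close> and \<open>|x| = 1\<close>, so the integral of its
  derivative vanishes. The derivative of the cutoff is \<open>-(x \<bullet> e) / (h |x|)\<close> on the layer between
  the spheres and \<open>0\<close> elsewhere.
\<close>

lemma integral_cutoff_by_parts:
  fixes F D :: "'a::euclidean_space \<Rightarrow> 'b::euclidean_space"
  assumes F: "continuous_on UNIV F" and D: "continuous_on UNIV D"
    and der: "\<And>x s. ((\<lambda>s. F (x + s *\<^sub>R e)) has_vector_derivative D (x + s *\<^sub>R e)) (at s)"
    and h: "0 < h" "h < 1" and e: "e \<noteq> 0"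
  shows "(\<integral>x. radial_cutoff h x *\<^sub>R D x \<partial>lborel) =
    (1 / h) *\<^sub>R (\<integral>x. indicator {y. 1 - h < norm y \<and> norm y < 1} x *\<^sub>R ((x \<bullet> e) / norm x) *\<^sub>R F x \<partial>lborel)"
proof -
  let ?c = "radial_cutoff h :: 'a \<Rightarrow> real" and ?A = "{y::'a. 1 - h < norm y \<and> norm y < 1}"
  let ?E = "{y::'a. norm y = 1 \<or> norm y = 1 - h}"
  let ?G = "\<lambda>x. indicator ?A x *\<^sub>R ((x \<bullet> e) / norm x) *\<^sub>R F x"
  have c: "continuous_on UNIV ?c"
    unfolding radial_cutoff_def by (intro continuous_intros) (use h in auto)
  have c0: "?c x = indicator (cball 0 1) x * ?c x" for x
    using h by (auto simp: radial_cutoff_def indicator_def max_def min_def zero_le_divide_iff)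
  have [measurable]: "F \<in> borel_measurable borel" "?A \<in> sets borel"
    using F by (auto intro: borel_measurable_continuous_onI)
  have intc: "integrable lborel (\<lambda>x. ?c x *\<^sub>R H x)" if "continuous_on UNIV H"
    for H :: "'a \<Rightarrow> 'b"
  proof -
    have "integrable lborel (\<lambda>x. indicator (cball 0 1) x *\<^sub>R ?c x *\<^sub>R H x)"
      by (intro borel_integrable_compact continuous_intros)
        (use c that in \<open>auto intro: continuous_on_subset\<close>)
    then show ?thesis
      by (subst c0) simp
  qed
  have intG: "integrable lborel ?G"
  proof (rule Bochner_Integration.integrable_bound)
    show "integrable lborel (\<lambda>x. indicator (cball (0::'a) 1) x *\<^sub>R (norm e *\<^sub>R F x))"
      by (intro borel_integrable_compact continuous_intros) (use F in \<open>auto intro: continuous_on_subset\<close>)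
    have "\<bar>(x \<bullet> e) / norm x\<bar> \<le> norm e" for x
      using Cauchy_Schwarz_ineq2[of x e] by (cases "x = 0") (auto simp: field_simps)
    then show "AE x in lborel. norm (?G x) \<le> norm (indicator (cball (0::'a) 1) x *\<^sub>R (norm e *\<^sub>R F x))"
      by (auto simp: indicator_def simp del: abs_divide intro!: mult_right_mono AE_I2)
  qed measurable
  have "(\<integral>x. ?c x *\<^sub>R D x - (1 / h) *\<^sub>R ?G x \<partial>lborel) = 0"
  proof (rule integral_directional_derivative_eq_0)
    show "integrable lborel (\<lambda>x. ?c x *\<^sub>R F x)"
      by (rule intc[OF F])
    show "integrable lborel (\<lambda>x. ?c x *\<^sub>R D x - (1 / h) *\<^sub>R ?G x)"
      by (intro Bochner_Integration.integrable_diff intc[OF D] Bochner_Integration.integrable_scaleR_right intG)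
    show "continuous_on {0..1} (\<lambda>s. ?c (x + s *\<^sub>R e) *\<^sub>R F (x + s *\<^sub>R e))" for x
      by (intro continuous_intros continuous_on_compose2[OF c] continuous_on_compose2[OF F]) auto
    show "finite {s. x + s *\<^sub>R e \<in> ?E}" for x
      using finite_line_meets_sphere[OF e, of x] by (simp add: Collect_disj_eq)
    show "((\<lambda>s. ?c (x + s *\<^sub>R e) *\<^sub>R F (x + s *\<^sub>R e)) has_vector_derivative
        ?c (x + s *\<^sub>R e) *\<^sub>R D (x + s *\<^sub>R e) - (1 / h) *\<^sub>R ?G (x + s *\<^sub>R e)) (at s)"
      if "x + s *\<^sub>R e \<notin> ?E" for x s
      by (rule has_vector_derivative_eq_rhs[OF has_vector_derivative_scaleR[OF radial_cutoff_derivative[OF h that] der]])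
        (simp add: divide_inverse mult_ac)
  qed
  then show ?thesis
    by (subst (asm) Bochner_Integration.integral_diff[OF intc[OF D] Bochner_Integration.integrable_scaleR_right[OF intG]])
      (simp only: integral_scaleR_right right_minus_eq)
qed

text \<open>
  Up to a null set the layer is the difference of two balls, and each ball contributes a multiple of the same
  integral by \<open>integral_cone_scale\<close>.
\<close>

lemma integral_radial_layer:
  fixes g :: "'a::euclidean_space \<Rightarrow> 'b::{banach, second_countable_topology}"
  assumes g: "g \<in> borel_measurable borel" and h: "0 < h" "h < 1"
    and int: "integrable lborel (\<lambda>x. indicator (ball 0 1) x *\<^sub>R g (x /\<^sub>R norm x))"
  shows "(\<integral>x. indicator {y. 1 - h < norm y \<and> norm y < 1} x *\<^sub>R g (x /\<^sub>R norm x) \<partial>lborel) =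
    ((1 - (1 - h) ^ DIM('a)) / DIM('a)) *\<^sub>R (\<integral>x. g x \<partial>sphere_measure)"
proof -
  let ?g = "\<lambda>x. g (x /\<^sub>R norm x)" and ?A = "{y::'a. 1 - h < norm y \<and> norm y < 1}"
  note [measurable] = borel_measurable_radial_extension[OF g]
  have int': "integrable lborel (\<lambda>x. indicator (ball 0 (1 - h)) x *\<^sub>R ?g x)"
  proof (rule Bochner_Integration.integrable_bound[OF int])
    show "AE x in lborel. norm (indicator (ball 0 (1 - h)) x *\<^sub>R ?g x) \<le> norm (indicator (ball 0 1) x *\<^sub>R ?g x)"
      using h by (auto simp: indicator_def)
  qed (auto intro!: borel_measurable_scaleR borel_measurable_indicator)
  have null: "AE x in lborel. x \<notin> sphere (0::'a) (1 - h)"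
    using negligible_sphere[of "0::'a" "1 - h"]
    by (intro AE_not_in) (auto simp: negligible_iff_null_sets null_sets_completion_iff)
  have [measurable]: "?A \<in> sets borel"
    by auto
  have "(\<integral>x. indicator ?A x *\<^sub>R ?g x \<partial>lborel) =
    (\<integral>x. indicator (ball 0 1) x *\<^sub>R ?g x - indicator (ball 0 (1 - h)) x *\<^sub>R ?g x \<partial>lborel)"
  proof (rule integral_cong_AE)
    show "AE x in lborel. indicator ?A x *\<^sub>R ?g x =
      indicator (ball 0 1) x *\<^sub>R ?g x - indicator (ball 0 (1 - h)) x *\<^sub>R ?g x"
      using null by eventually_elim (use h in \<open>auto simp: indicator_def\<close>)
  qed (auto intro!: borel_measurable_scaleR borel_measurable_indicator borel_measurable_diff)
  also have "\<dots> = (1 - (1 - h) ^ DIM('a)) *\<^sub>R (\<integral>x. indicator (ball 0 1) x *\<^sub>R ?g x \<partial>lborel)"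
    using integral_cone_scale[OF g, of "1 - h"] h
    by (simp add: Bochner_Integration.integral_diff[OF int int'] algebra_simps)
  finally show ?thesis
    by (simp add: integral_sphere_measure[OF g])
qed

lemma bounded_continuous_cball:
  fixes F :: "'a::euclidean_space \<Rightarrow> 'b::real_normed_vector"
  assumes "continuous_on UNIV F"
  obtains M where "M > 0" "\<And>x. norm x \<le> 1 \<Longrightarrow> norm (F x) \<le> M"
proof -
  have "bounded (F ` cball 0 1)"
    by (intro compact_imp_bounded compact_continuous_image continuous_on_subset[OF assms]) auto
  then show thesis
    using that by (auto simp: bounded_pos)
qed

text \<open>
  Averages over thin layers at the sphere converge to the surface integral. For integrands that
  are constant on rays, \<open>integral_radial_layer\<close> gives the average exactly, and the factor
  \<open>c\<^sub>n = (1 - (1 - h\<^sub>n)\<^sup>N) / (N h\<^sub>n)\<close> tends to \<open>1\<close>. Replacing \<open>F(x)\<close> by \<open>F(x/|x|)\<close> changes the average by an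
  amount that tends to \<open>0\<close>, because \<open>F\<close> is uniformly continuous and \<open>x\<close> has distance less than
  \<open>h\<^sub>n\<close> from \<open>x/|x|\<close>.
\<close>

lemma tendsto_radial_layer:
  fixes F :: "'a::euclidean_space \<Rightarrow> 'b::euclidean_space"
  assumes F: "continuous_on UNIV F" and h: "\<And>n. 0 < h n" "\<And>n. h n < 1" "h \<longlonglongrightarrow> 0"
  shows "(\<lambda>n. (1 / h n) *\<^sub>R
      (\<integral>x. indicator {y. 1 - h n < norm y \<and> norm y < 1} x *\<^sub>R ((x \<bullet> e) / norm x) *\<^sub>R F x \<partial>lborel))
    \<longlonglongrightarrow> (\<integral>x. (x \<bullet> e) *\<^sub>R F x \<partial>sphere_measure)"
proof -
  let ?A = "\<lambda>n. {y::'a. 1 - h n < norm y \<and> norm y < 1}"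
  let ?u = "\<lambda>x::'a. x /\<^sub>R norm x"
  define g where "g x = (x \<bullet> e) *\<^sub>R F x" for x
  define S where "S = (\<integral>x. g x \<partial>sphere_measure)"
  define V where "V = measure lborel (ball (0::'a) 1)"
  define c where "c n = (1 - (1 - h n) ^ DIM('a)) / (DIM('a) * h n)" for n
  have [measurable]: "F \<in> borel_measurable borel" "\<And>n. ?A n \<in> sets borel"
    using F by (auto intro: borel_measurable_continuous_onI)
  have [measurable]: "g \<in> borel_measurable borel"
    unfolding g_def by measurable
  note [measurable] = borel_measurable_radial_extension[OF this]
  obtain M where M: "M > 0" "\<And>x. norm x \<le> 1 \<Longrightarrow> norm (F x) \<le> M"
    using bounded_continuous_cball[OF F] by blast
  have inner_le: "\<bar>x \<bullet> e\<bar> / norm x \<le> norm e" for x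
    using Cauchy_Schwarz_ineq2[of x e] by (cases "x = 0") (auto simp: field_simps)
  have gu: "g (?u x) = ((x \<bullet> e) / norm x) *\<^sub>R F (?u x)" for x
    by (simp add: g_def divide_inverse mult.commute)
  have nu: "norm (?u x) \<le> 1" for x
    by (cases "x = 0") auto
  have bd: "integrable lborel (\<lambda>x. indicator U x *\<^sub>R f x)"
    if [measurable]: "f \<in> borel_measurable borel" "U \<in> sets borel" and U: "U \<subseteq> ball 0 1"
      and f: "\<And>x. norm x < 1 \<Longrightarrow> norm (f x) \<le> norm e * M" for f :: "'a \<Rightarrow> 'b" and U
  proof (rule Bochner_Integration.integrable_bound)
    show "integrable lborel (\<lambda>x. indicator (ball (0::'a) 1) x *\<^sub>R (norm e * M))"
      by (rule Bochner_Integration.integrable_scaleR_left[OF integrable_real_indicator])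
        (simp_all add: emeasure_lborel_ball_finite del: infinity_ennreal_def)
    show "AE x in lborel. norm (indicator U x *\<^sub>R f x) \<le> norm (indicator (ball 0 1) x *\<^sub>R (norm e * M))"
      using U f M(1) by (auto simp: indicator_def intro!: AE_I2)
  qed (auto intro!: borel_measurable_scaleR borel_measurable_indicator)
  have fb1: "norm (((x \<bullet> e) / norm x) *\<^sub>R F x) \<le> norm e * M" if "norm x < 1" for x
    using mult_mono[OF inner_le[of x] M(2)[of x]] that by simp
  have fb2: "norm (g (?u x)) \<le> norm e * M" for x
    unfolding gu using mult_mono[OF inner_le[of x] M(2)[OF nu[of x]]] by simp
  have A_sub: "?A n \<subseteq> ball 0 1" for n
    by auto
  have int1: "integrable lborel (\<lambda>x. indicator (?A n) x *\<^sub>R ((x \<bullet> e) / norm x) *\<^sub>R F x)" for n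
    by (rule bd[OF _ _ A_sub]) (use fb1 in auto)
  have int2: "integrable lborel (\<lambda>x. indicator (?A n) x *\<^sub>R g (?u x))" for n
    by (rule bd[OF _ _ A_sub]) (use fb2 in auto)
  have int3: "integrable lborel (\<lambda>x. indicator (ball 0 1) x *\<^sub>R g (?u x))"
    by (rule bd) (use fb2 in auto)
  have indB: "integrable lborel (indicator (ball (0::'a) 1) :: 'a \<Rightarrow> real)"
    by (rule integrable_real_indicator) (simp_all add: emeasure_lborel_ball_finite del: infinity_ennreal_def)
  have intA: "integrable lborel (indicator (?A n) :: 'a \<Rightarrow> real)" for n
    by (rule Bochner_Integration.integrable_bound[of _ "indicator (ball 0 1) :: 'a \<Rightarrow> real"])
      (use indB in \<open>auto simp: indicator_def\<close>)
  have layer: "(\<integral>x. indicator (?A n) x *\<^sub>R g (?u x) \<partial>lborel) = (h n * c n) *\<^sub>R S" for n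
    unfolding S_def using integral_radial_layer[where g = g and h = "h n"] h(1)[of n] h(2)[of n] int3 by (simp add: c_def)
  have vol: "(\<integral>x. indicator (?A n) x \<partial>lborel) \<le> h n * (DIM('a) * V)" for n
  proof -
    have "(\<integral>x. indicator (?A n) x *\<^sub>R (1::real) \<partial>lborel) =
      ((1 - (1 - h n) ^ DIM('a)) / DIM('a)) *\<^sub>R (\<integral>x. 1 \<partial>(sphere_measure :: 'a measure))"
      using integral_radial_layer[where g = "\<lambda>_::'a. 1::real" and h = "h n"] h(1)[of n] h(2)[of n] indB
      by simp
    also have "(\<integral>x. 1 \<partial>(sphere_measure :: 'a measure)) = DIM('a) * V"
      using integral_sphere_measure[of "\<lambda>_::'a. 1::real"] by (simp add: V_def)
    finally have eq: "(\<integral>x. indicator (?A n) x \<partial>lborel) = (1 - (1 - h n) ^ DIM('a)) * V"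
      by simp
    have "1 - (1 - h n) ^ DIM('a) \<le> DIM('a) * h n"
      using Bernoulli_inequality[of "- h n" "DIM('a)"] h(2)[of n] by simp
    from mult_right_mono[OF this, of V] show ?thesis
      unfolding eq by (simp add: V_def mult_ac)
  qed
  have c_lim: "c \<longlonglongrightarrow> 1"
  proof -
    \<comment> \<open>The limit of \<open>N c\<^sub>n\<close> is the derivative of \<open>r\<^sup>N\<close> at \<open>1\<close>.\<close>
    have "((\<lambda>r::real. r ^ DIM('a)) has_real_derivative DIM('a)) (at 1)"
      by (auto intro!: derivative_eq_intros)
    then have "((\<lambda>y. (y ^ DIM('a) - 1 ^ DIM('a)) / (y - 1)) \<longlongrightarrow> DIM('a)) (at (1::real))"
      by (simp add: has_field_derivative_iff)
    moreover have "filterlim (\<lambda>n. 1 - h n) (at 1) sequentially"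
      unfolding filterlim_at using tendsto_diff[OF tendsto_const h(3), of 1] h(1)
      by (auto simp: less_imp_neq[THEN not_sym])
    ultimately have "(\<lambda>n. ((1 - h n) ^ DIM('a) - 1 ^ DIM('a)) / ((1 - h n) - 1)) \<longlonglongrightarrow> DIM('a)"
      by (rule filterlim_compose)
    then have "(\<lambda>n. ((1 - h n) ^ DIM('a) - 1 ^ DIM('a)) / ((1 - h n) - 1) / DIM('a)) \<longlonglongrightarrow> DIM('a) / DIM('a)"
      by (intro tendsto_divide) auto
    moreover have "((1 - h n) ^ DIM('a) - 1 ^ DIM('a)) / ((1 - h n) - 1) / DIM('a) = c n" for n
      using h(1)[of n] by (simp add: c_def field_simps)
    ultimately show ?thesis
      by simp
  qed
  have uc: "uniformly_continuous_on (cball 0 1) F"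
    by (intro compact_uniformly_continuous continuous_on_subset[OF F]) auto
  have diff: "(\<lambda>n. (1 / h n) *\<^sub>R (\<integral>x. indicator (?A n) x *\<^sub>R ((x \<bullet> e) / norm x) *\<^sub>R F x \<partial>lborel) - c n *\<^sub>R S)
      \<longlonglongrightarrow> 0"
  proof (rule tendsto_norm_zero_cancel, rule LIMSEQ_I)
    fix \<epsilon> :: real assume \<epsilon>: "0 < \<epsilon>"
    \<comment> \<open>The error of the average is at most \<open>N V |e| \<delta>\<close>, where \<open>N V\<close> is the total surface measure;
      adding \<open>1\<close> to the factors keeps the quotient meaningful when they vanish.\<close>
    define \<delta> where "\<delta> = \<epsilon> / (2 * (norm e + 1) * (DIM('a) * V + 1))"
    have V0: "V \<ge> 0"
      by (simp add: V_def)
    have \<delta>: "\<delta> > 0"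
      using \<epsilon> V0 by (auto simp: \<delta>_def intro!: divide_pos_pos mult_pos_pos add_nonneg_pos)
    obtain d where d: "d > 0" "\<And>x y. norm x \<le> 1 \<Longrightarrow> norm y \<le> 1 \<Longrightarrow> dist x y < d \<Longrightarrow> dist (F x) (F y) < \<delta>"
      using uc \<delta> unfolding uniformly_continuous_on_def by (auto simp: dist_commute)
    obtain n0 where n0: "\<And>n. n \<ge> n0 \<Longrightarrow> h n < d"
      using LIMSEQ_D[OF h(3) d(1)] h(1) by force
    have "norm ((1 / h n) *\<^sub>R (\<integral>x. indicator (?A n) x *\<^sub>R ((x \<bullet> e) / norm x) *\<^sub>R F x \<partial>lborel) - c n *\<^sub>R S) < \<epsilon>"
      if n: "n \<ge> n0" for n
    proof -
      have pt: "norm (indicator (?A n) x *\<^sub>R ((x \<bullet> e) / norm x) *\<^sub>R F x - indicator (?A n) x *\<^sub>R g (?u x)) \<le>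
          indicator (?A n) x * (norm e * \<delta>)" for x
      proof (cases "x \<in> ?A n")
        case True
        then have x: "norm x < 1" "1 - h n < norm x" "x \<noteq> 0"
          using h(2)[of n] by auto
        have "dist x (?u x) = norm ((1 - 1 / norm x) *\<^sub>R x)"
          by (simp add: dist_norm algebra_simps inverse_eq_divide)
        also have "\<dots> = 1 - norm x"
          using x by (simp add: abs_if field_simps)
        finally have "dist (F x) (F (?u x)) < \<delta>"
          using x nu[of x] n0[OF n] by (intro d(2)) auto
        then have "\<bar>x \<bullet> e\<bar> / norm x * norm (F x - F (?u x)) \<le> norm e * \<delta>"
          by (intro mult_mono inner_le) (auto simp: dist_norm)
        then show ?thesis
          using True unfolding gu by (simp flip: scaleR_diff_right)
      qed auto
      have "norm ((\<integral>x. indicator (?A n) x *\<^sub>R ((x \<bullet> e) / norm x) *\<^sub>R F x \<partial>lborel) - (h n * c n) *\<^sub>R S) =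
         norm (\<integral>x. indicator (?A n) x *\<^sub>R ((x \<bullet> e) / norm x) *\<^sub>R F x - indicator (?A n) x *\<^sub>R g (?u x) \<partial>lborel)"
        by (subst Bochner_Integration.integral_diff[OF int1 int2]) (simp only: layer)
      also have "\<dots> \<le> (\<integral>x. indicator (?A n) x * (norm e * \<delta>) \<partial>lborel)"
        by (rule order_trans[OF integral_norm_bound integral_mono])
            (use int1[of n] int2[of n] intA[of n] pt in auto)
      also have "\<dots> = (\<integral>x. indicator (?A n) x \<partial>lborel) * (norm e * \<delta>)"
        by simp
      also have "\<dots> \<le> h n * (DIM('a) * V) * (norm e * \<delta>)"
        using vol[of n] \<delta> by (intro mult_right_mono) auto
      finally have 1: "norm ((\<integral>x. indicator (?A n) x *\<^sub>R ((x \<bullet> e) / norm x) *\<^sub>R F x \<partial>lborel) - (h n * c n) *\<^sub>R S)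
        \<le> h n * (DIM('a) * V * (norm e * \<delta>))"
        by (simp add: mult_ac)
      have "norm ((1 / h n) *\<^sub>R (\<integral>x. indicator (?A n) x *\<^sub>R ((x \<bullet> e) / norm x) *\<^sub>R F x \<partial>lborel) - c n *\<^sub>R S) =
        norm ((1 / h n) *\<^sub>R ((\<integral>x. indicator (?A n) x *\<^sub>R ((x \<bullet> e) / norm x) *\<^sub>R F x \<partial>lborel) - (h n * c n) *\<^sub>R S))"
        using h(1)[of n] by (simp add: scaleR_diff_right)
      also have "\<dots> \<le> DIM('a) * V * (norm e * \<delta>)"
        using mult_left_mono[OF 1, of "1 / h n"] h(1)[of n] by (simp only: norm_scaleR) simp
      also have "\<dots> \<le> (DIM('a) * V + 1) * ((norm e + 1) * \<delta>)"
        using V0 \<delta> by (intro mult_mono) auto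
      also have "\<dots> = \<epsilon> / 2"
      proof -
        have "DIM('a) * V + 1 > 0" "norm e + 1 > 0"
          using V0 by (auto intro!: add_nonneg_pos)
        then show ?thesis
          unfolding \<delta>_def by (simp add: divide_simps)
      qed
      also have "\<dots> < \<epsilon>"
        using \<epsilon> by simp
      finally show ?thesis .
    qed
    then show "\<exists>n0. \<forall>n\<ge>n0. norm (norm ((1 / h n) *\<^sub>R (\<integral>x. indicator (?A n) x *\<^sub>R ((x \<bullet> e) / norm x) *\<^sub>R F x \<partial>lborel) - c n *\<^sub>R S) - 0) < \<epsilon>"
      by auto
  qed
  have "(\<lambda>n. c n *\<^sub>R S) \<longlonglongrightarrow> 1 *\<^sub>R S"
    by (intro tendsto_intros c_lim)
  from tendsto_add[OF diff this] show ?thesis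
    by (simp add: S_def g_def)
qed

text \<open>
  The divergence theorem for the vector field \<open>F e\<close>, obtained by letting \<open>h \<rightarrow> 0\<close> in
  \<open>integral_cutoff_by_parts\<close>: on the left the cutoffs converge boundedly to the indicator function
  of the ball, on the right the layer averages converge to the surface integral.
\<close>

lemma divergence_ball:
  fixes F D :: "'a::euclidean_space \<Rightarrow> 'b::euclidean_space"
  assumes F: "continuous_on UNIV F" and D: "continuous_on UNIV D"
    and der: "\<And>x s. ((\<lambda>s. F (x + s *\<^sub>R e)) has_vector_derivative D (x + s *\<^sub>R e)) (at s)"
    and e: "e \<noteq> 0"
  shows "(\<integral>x. indicator (ball 0 1) x *\<^sub>R D x \<partial>lborel) = (\<integral>x. (x \<bullet> e) *\<^sub>R F x \<partial>sphere_measure)"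
proof -
  define h where "h n = 1 / real (n + 2)" for n
  have h: "\<And>n. 0 < h n" "\<And>n. h n < 1" "h \<longlonglongrightarrow> 0"
    unfolding h_def using LIMSEQ_ignore_initial_segment[OF lim_1_over_n, of 2] by auto
  have "(\<lambda>n. \<integral>x. radial_cutoff (h n) x *\<^sub>R D x \<partial>lborel) \<longlonglongrightarrow> (\<integral>x. (x \<bullet> e) *\<^sub>R F x \<partial>sphere_measure)"
    using tendsto_radial_layer[OF F h, of e] integral_cutoff_by_parts[OF F D der h(1,2) e] by simp
  moreover have "(\<lambda>n. \<integral>x. radial_cutoff (h n) x *\<^sub>R D x \<partial>lborel) \<longlonglongrightarrow> (\<integral>x. indicator (ball 0 1) x *\<^sub>R D x \<partial>lborel)"
  proof (rule integral_dominated_convergence)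
    show [measurable]: "(\<lambda>x. indicator (ball 0 1) x *\<^sub>R D x) \<in> borel_measurable lborel"
      using borel_measurable_continuous_onI[OF D] by (auto intro!: borel_measurable_scaleR borel_measurable_indicator)
    show "(\<lambda>x. radial_cutoff (h n) x *\<^sub>R D x) \<in> borel_measurable lborel" for n
      using D h(1)[of n] unfolding radial_cutoff_def
      by (auto intro!: borel_measurable_continuous_onI continuous_intros)
    show "integrable lborel (\<lambda>x. indicator (cball (0::'a) 1) x *\<^sub>R norm (D x))"
      by (intro borel_integrable_compact continuous_intros continuous_on_subset[OF D]) auto
    show "AE x in lborel. norm (radial_cutoff (h n) x *\<^sub>R D x) \<le> indicator (cball 0 1) x *\<^sub>R norm (D x)" for n
    proof (rule AE_I2)
      fix x :: 'a
      have "0 \<le> radial_cutoff (h n) x" "radial_cutoff (h n) x \<le> 1" "norm x > 1 \<Longrightarrow> radial_cutoff (h n) x = 0"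
        using h(1)[of n] by (auto simp: radial_cutoff_def max_def min_def zero_le_divide_iff)
      then show "norm (radial_cutoff (h n) x *\<^sub>R D x) \<le> indicator (cball 0 1) x *\<^sub>R norm (D x)"
        by (auto simp: indicator_def intro!: mult_left_le_one_le)
    qed
    show "AE x in lborel. (\<lambda>n. radial_cutoff (h n) x *\<^sub>R D x) \<longlonglongrightarrow> indicator (ball 0 1) x *\<^sub>R D x"
    proof (rule AE_I2)
      fix x :: 'a
      have "(\<lambda>n. radial_cutoff (h n) x) \<longlonglongrightarrow> indicator (ball 0 1) x"
      proof (cases "norm x < 1")
        case True
        then have "eventually (\<lambda>n. h n < 1 - norm x) sequentially"
          using order_tendstoD(2)[OF h(3)] by simp
        then have "eventually (\<lambda>n. radial_cutoff (h n) x = 1) sequentially"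
          by eventually_elim (use h(1) in \<open>auto simp: radial_cutoff_def min_def field_simps\<close>)
        with True show ?thesis
          by (auto intro: tendsto_eventually)
      next
        case False
        then have "radial_cutoff (h n) x = 0" for n
          using h(1)[of n] by (auto simp: radial_cutoff_def max_def min_def zero_le_divide_iff)
        with False show ?thesis
          by simp
      qed
      then show "(\<lambda>n. radial_cutoff (h n) x *\<^sub>R D x) \<longlonglongrightarrow> indicator (ball 0 1) x *\<^sub>R D x"
        by (intro tendsto_intros)
    qed
  qed
  ultimately show ?thesis
    using LIMSEQ_unique by blast
qed

section \<open>Derivatives of the Gaussians and of the symbol\<close>

text \<open>
  These numbers are the coefficients in
  \<open>(d/ds)\<^sup>k (s\<^sup>b exp (-t s\<^sup>2)) = \<Sum>\<^sub>a c\<^sub>k\<^sub>,\<^sub>a s\<^bsup>2a + b - k\<^esup> t\<^sup>a exp (-t s\<^sup>2)\<close>, up to normalization those of the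
  Hermite polynomials when \<open>b = 0\<close>. The recursion is the product rule: differentiating the power
  of \<open>s\<close> keeps \<open>a\<close>, and differentiating the exponential raises it.
\<close>

fun gauss_coeff :: "nat \<Rightarrow> nat \<Rightarrow> nat \<Rightarrow> real" where
  "gauss_coeff b 0 a = (if a = 0 then 1 else 0)"
| "gauss_coeff b (Suc k) 0 = (real b - real k) * gauss_coeff b k 0"
| "gauss_coeff b (Suc k) (Suc a) =
    (real (2 * Suc a + b) - real k) * gauss_coeff b k (Suc a) - 2 * gauss_coeff b k a"

lemma gauss_coeff_above: "k < a \<Longrightarrow> gauss_coeff b k a = 0"
  by (induction b k a rule: gauss_coeff.induct) auto

text \<open>
  Negative powers of \<open>s\<close> never occur: the factor \<open>2a + b - k\<close> in the recursion vanishes when the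
  exponent reaches \<open>0\<close>. Hence the truncated subtraction in the exponents below is harmless.
\<close>

lemma gauss_coeff_below: "2 * a + b < k \<Longrightarrow> gauss_coeff b k a = 0"
proof (induction b k a rule: gauss_coeff.induct)
  case (2 b k)
  then show ?case by (cases "b = k") auto
next
  case (3 b k a)
  then show ?case by (cases "2 * Suc a + b = k") auto
qed auto

text \<open>
  The factors \<open>t\<^sup>a exp (-t |x|\<^sup>2)\<close> are abstracted to a sequence \<open>u\<close>. In this way one computation covers
  both the Gaussians and their integrals over \<open>t\<close>, where \<open>u\<^sub>a = a! / |x|\<^bsup>2a + 2\<^esup>\<close>.
\<close>

definition gauss_sum :: "nat \<Rightarrow> nat \<Rightarrow> (nat \<Rightarrow> real) \<Rightarrow> real \<Rightarrow> real" where
  "gauss_sum b k u s = (\<Sum>a\<le>k. gauss_coeff b k a * s ^ (2 * a + b - k) * u a)"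

text \<open>
  The hypothesis \<open>u\<^sub>a' = -2 s u\<^sub>a\<^sub>+\<^sub>1\<close> is all that the product rule needs. It holds for
  \<open>t\<^sup>a exp (-t (\<rho> + s\<^sup>2))\<close> and also for \<open>a! / (\<rho> + s\<^sup>2)\<^bsup>a + 1\<^esup>\<close>, so differentiation under the integral over
  \<open>t\<close> never has to be justified analytically.
\<close>

lemma has_real_derivative_gauss_sum:
  assumes u: "\<And>a. (u a has_real_derivative - 2 * s * u (Suc a) s) (at s)"
  shows "((\<lambda>s. gauss_sum b k (\<lambda>a. u a s) s) has_real_derivative
    gauss_sum b (Suc k) (\<lambda>a. u a s) s) (at s)"
proof -
  let ?c = "gauss_coeff b"
  let ?d = "\<lambda>a. ?c k a * (real (2 * a + b) - real k) * s ^ (2 * a + b - Suc k) * u a s"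
  let ?e = "\<lambda>a. 2 * ?c k a * s ^ (2 * Suc a + b - Suc k) * u (Suc a) s"
  have "((\<lambda>s. ?c k a * s ^ (2 * a + b - k) * u a s) has_real_derivative ?d a - ?e a) (at s)" for a
  proof (cases "2 * a + b < k")
    case True
    then show ?thesis
      by (simp add: gauss_coeff_below)
  next
    case False
    then have "2 * Suc a + b - Suc k = Suc (2 * a + b - k)" "real (2 * a + b) - real k = real (2 * a + b - k)"
      "2 * a + b - Suc k = 2 * a + b - k - Suc 0"
      by auto
    then show ?thesis
      by (auto intro!: derivative_eq_intros u simp: algebra_simps)
  qed
  then have "((\<lambda>s. gauss_sum b k (\<lambda>a. u a s) s) has_real_derivative (\<Sum>a\<le>k. ?d a - ?e a)) (at s)"
    unfolding gauss_sum_def by (intro DERIV_sum) auto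
  \<comment> \<open>The added summand with index \<open>k + 1\<close> is zero.\<close>
  also have "(\<Sum>a\<le>k. ?d a - ?e a) = (\<Sum>a\<le>Suc k. ?d a) - (\<Sum>a\<le>k. ?e a)"
    by (simp add: sum_subtractf gauss_coeff_above)
  also have "\<dots> = ?d 0 + (\<Sum>a\<le>k. ?d (Suc a) - ?e a)"
    by (subst sum.atMost_Suc_shift) (simp add: sum_subtractf)
  also have "\<dots> = gauss_sum b (Suc k) (\<lambda>a. u a s) s"
    unfolding gauss_sum_def by (subst sum.atMost_Suc_shift) (simp add: algebra_simps)
  finally show ?thesis .
qed

text \<open>
  The numerator \<open>x\<^sub>i\<^sup>2\<close> either is constant along the direction \<open>j\<close> (if \<open>i \<noteq> j\<close>) or is the power \<open>x\<^sub>j\<^sup>2\<close>.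
  Splitting it as a constant factor times \<open>x\<^sub>j\<close> to the power \<open>axial_degree i j\<close> treats both cases
  at once.
\<close>

definition transverse_factor :: "'n::finite \<Rightarrow> 'n \<Rightarrow> real^'n \<Rightarrow> real" where
  "transverse_factor i j x = (if i = j then 1 else (x $ i)\<^sup>2)"

definition axial_degree :: "'n \<Rightarrow> 'n \<Rightarrow> nat" where
  "axial_degree i j = (if i = j then 2 else 0)"

text \<open>
  The \<open>k\<close>-th derivative in direction \<open>j\<close> of the Gaussian \<open>x\<^sub>i\<^sup>2 exp (-t |x|\<^sup>2)\<close>; see
  \<open>gauss_deriv_0\<close> and \<open>has_real_derivative_gauss_deriv\<close>.
\<close>

definition gauss_deriv :: "'n::finite \<Rightarrow> 'n \<Rightarrow> nat \<Rightarrow> real \<Rightarrow> real^'n \<Rightarrow> real" where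
  "gauss_deriv i j k t x = transverse_factor i j x *
     gauss_sum (axial_degree i j) k (\<lambda>a. t ^ a * exp (- t * (norm x)\<^sup>2)) (x $ j)"

text \<open>
  The \<open>k\<close>-th derivative in direction \<open>j\<close> of the symbol \<open>x\<^sub>i\<^sup>2 / |x|\<^sup>2\<close>, in the form that arises by
  integrating \<open>gauss_deriv\<close> over \<open>t\<close> term by term.
\<close>

definition riesz_deriv :: "'n::finite \<Rightarrow> 'n \<Rightarrow> nat \<Rightarrow> real^'n \<Rightarrow> real" where
  "riesz_deriv i j k x = transverse_factor i j x *
     gauss_sum (axial_degree i j) k (\<lambda>a. fact a / ((norm x)\<^sup>2) ^ Suc a) (x $ j)"

lemma gauss_deriv_0: "gauss_deriv i j 0 t x = (x $ i)\<^sup>2 * exp (- t * (norm x)\<^sup>2)"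
  by (simp add: gauss_deriv_def gauss_sum_def transverse_factor_def axial_degree_def)

lemma riesz_deriv_0: "riesz_deriv i j 0 x = riesz_hat i x"
  by (simp add: riesz_deriv_def riesz_hat_def gauss_sum_def transverse_factor_def axial_degree_def)

lemma transverse_factor_line [simp]: "transverse_factor i j (x + s *\<^sub>R axis j 1) = transverse_factor i j x"
  by (simp add: transverse_factor_def axis_def)

lemma norm_line_sqr: "(norm (x + s *\<^sub>R axis j 1 :: real^'n::finite))\<^sup>2 = (norm x)\<^sup>2 - (x $ j)\<^sup>2 + (x $ j + s)\<^sup>2"
proof -
  have "x \<bullet> axis j 1 = x $ j"
    by (simp add: inner_axis)
  then show ?thesis
    unfolding power2_norm_eq_inner
    by (simp add: inner_simps inner_commute[of "axis j 1"] inner_axis_axis power2_eq_square algebra_simps)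
qed

text \<open>
  On a line in direction \<open>j\<close>, the square of the norm is \<open>\<rho> + r\<^sup>2\<close> with \<open>r = x\<^sub>j + s\<close> and \<open>\<rho>\<close> constant.
  Hence both derivative formulas reduce to the one-dimensional statement in the variable \<open>r\<close>.
\<close>

lemma has_real_derivative_line:
  fixes x :: "real^'n::finite"
  assumes f: "\<And>s. f (x + s *\<^sub>R axis j 1) = transverse_factor i j x * gauss_sum b k (\<lambda>a. u a (x $ j + s)) (x $ j + s)"
    and g: "g (x + s *\<^sub>R axis j 1) = transverse_factor i j x * gauss_sum b (Suc k) (\<lambda>a. u a (x $ j + s)) (x $ j + s)"
    and u: "\<And>a. (u a has_real_derivative - 2 * (x $ j + s) * u (Suc a) (x $ j + s)) (at (x $ j + s))"
  shows "((\<lambda>s. f (x + s *\<^sub>R axis j 1)) has_real_derivative g (x + s *\<^sub>R axis j 1)) (at s)"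
proof -
  have "((\<lambda>s. x $ j + s) has_real_derivative 1) (at s)"
    by (auto intro!: derivative_eq_intros)
  then have "((\<lambda>s. gauss_sum b k (\<lambda>a. u a (x $ j + s)) (x $ j + s)) has_real_derivative
      gauss_sum b (Suc k) (\<lambda>a. u a (x $ j + s)) (x $ j + s)) (at s)"
    using DERIV_chain2[where f = "\<lambda>s. gauss_sum b k (\<lambda>a. u a s) s" and g = "\<lambda>s. x $ j + s" and x = s
        and Db = 1 and s = UNIV, OF has_real_derivative_gauss_sum[where u = u, OF u]]
    by simp
  then show ?thesis
    unfolding f g by (rule DERIV_cmult)
qed

lemma has_real_derivative_gauss_deriv:
  "((\<lambda>s. gauss_deriv i j k t (x + s *\<^sub>R axis j 1)) has_real_derivative
    gauss_deriv i j (Suc k) t (x + s *\<^sub>R axis j 1)) (at s)"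
proof (rule has_real_derivative_line)
  let ?u = "\<lambda>a r. t ^ a * exp (- t * ((norm x)\<^sup>2 - (x $ j)\<^sup>2 + r\<^sup>2))"
  show "gauss_deriv i j m t (x + r *\<^sub>R axis j 1) =
      transverse_factor i j x * gauss_sum (axial_degree i j) m (\<lambda>a. ?u a (x $ j + r)) (x $ j + r)" for r m
    by (simp only: gauss_deriv_def norm_line_sqr transverse_factor_line vector_add_component
        vector_scaleR_component axis_nth real_scaleR_def mult_1_right)
  then show "gauss_deriv i j (Suc k) t (x + s *\<^sub>R axis j 1) =
      transverse_factor i j x * gauss_sum (axial_degree i j) (Suc k) (\<lambda>a. ?u a (x $ j + s)) (x $ j + s)" .
  show "(?u a has_real_derivative - 2 * r * ?u (Suc a) r) (at r)" for a r
    by (auto intro!: derivative_eq_intros)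
qed

lemma has_real_derivative_reciprocal_power:
  fixes c r :: real
  assumes "c + r\<^sup>2 \<noteq> 0"
  shows "((\<lambda>r. fact a / (c + r\<^sup>2) ^ Suc a) has_real_derivative
    - 2 * r * (fact (Suc a) / (c + r\<^sup>2) ^ Suc (Suc a))) (at r)"
proof -
  define Q where "Q = c + r\<^sup>2"
  have "((\<lambda>r. c + r\<^sup>2) has_real_derivative 2 * r) (at r)"
    by (auto intro!: derivative_eq_intros)
  from DERIV_cmult[OF DERIV_inverse'[OF DERIV_power[OF this, of "Suc a"]], of "fact a"] assms
  have "((\<lambda>r. fact a / (c + r\<^sup>2) ^ Suc a) has_real_derivative
      fact a * - (inverse (Q ^ Suc a) * (real (Suc a) * (2 * r * Q ^ a)) * inverse (Q ^ Suc a))) (at r)"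
    by (simp add: Q_def divide_inverse del: power_Suc)
  also have "fact a * - (inverse (Q ^ Suc a) * (real (Suc a) * (2 * r * Q ^ a)) * inverse (Q ^ Suc a)) =
      - 2 * r * (fact (Suc a) / Q ^ Suc (Suc a))"
    using assms by (simp add: field_simps flip: Q_def)
  finally show ?thesis
    by (simp only: Q_def)
qed

lemma has_real_derivative_riesz_deriv:
  assumes "x + s *\<^sub>R axis j 1 \<noteq> 0"
  shows "((\<lambda>s. riesz_deriv i j k (x + s *\<^sub>R axis j 1)) has_real_derivative
    riesz_deriv i j (Suc k) (x + s *\<^sub>R axis j 1)) (at s)"
proof (rule has_real_derivative_line)
  let ?u = "\<lambda>a r. fact a / ((norm x)\<^sup>2 - (x $ j)\<^sup>2 + r\<^sup>2) ^ Suc a"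
  show "riesz_deriv i j m (x + r *\<^sub>R axis j 1) =
      transverse_factor i j x * gauss_sum (axial_degree i j) m (\<lambda>a. ?u a (x $ j + r)) (x $ j + r)" for r m
    by (simp only: riesz_deriv_def norm_line_sqr transverse_factor_line vector_add_component
        vector_scaleR_component axis_nth real_scaleR_def mult_1_right)
  then show "riesz_deriv i j (Suc k) (x + s *\<^sub>R axis j 1) =
      transverse_factor i j x * gauss_sum (axial_degree i j) (Suc k) (\<lambda>a. ?u a (x $ j + s)) (x $ j + s)" .
  have "(norm x)\<^sup>2 - (x $ j)\<^sup>2 + (x $ j + s)\<^sup>2 \<noteq> 0"
    using assms norm_line_sqr[of x s j] by (metis norm_eq_zero power_eq_0_iff)
  then show "(?u a has_real_derivative - 2 * (x $ j + s) * ?u (Suc a) (x $ j + s)) (at (x $ j + s))" for a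
    by (rule has_real_derivative_reciprocal_power)
qed

text \<open>
  A partial derivative depends only on values near the point, and the complement of the origin is
  open, so the arbitrary values of the iterated derivatives at the origin do not propagate.
\<close>

lemma partial_deriv_iterate_riesz_hat:
  fixes x :: "real^'n::finite"
  assumes "x \<noteq> 0"
  shows "(partial_deriv j ^^ k) (riesz_hat i) x = riesz_deriv i j k x"
  using assms
proof (induction k arbitrary: x)
  case 0
  then show ?case by (simp add: riesz_deriv_0)
next
  case (Suc k)
  have "((\<lambda>s. riesz_deriv i j k (x + s *\<^sub>R axis j 1)) has_real_derivative riesz_deriv i j (Suc k) x) (at 0)"
    using has_real_derivative_riesz_deriv[of x 0 j i k] Suc.prems by simp
  moreover have "open ((\<lambda>s. x + s *\<^sub>R axis j 1) -` (- {0}))"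
    by (intro open_vimage continuous_intros)
  ultimately have "((\<lambda>s. (partial_deriv j ^^ k) (riesz_hat i) (x + s *\<^sub>R axis j 1)) has_real_derivative
      riesz_deriv i j (Suc k) x) (at 0)"
    by (rule has_field_derivative_transform_within_open) (use Suc in auto)
  then show ?case
    by (simp add: partial_deriv_def[of j "(partial_deriv j ^^ k) (riesz_hat i)"] DERIV_imp_deriv)
qed

text \<open>
  Every term of the sum has total degree \<open>2a + 2 - k\<close> in \<open>x\<close>, which reflects that the symbol is
  homogeneous of degree \<open>0\<close>. Integration over \<open>t\<close> turns this into the uniform bound \<open>C / |x|\<^sup>k\<close>.
\<close>

lemma abs_gauss_deriv_le:
  fixes x :: "real^'n::finite"
  assumes "0 \<le> t"
  shows "\<bar>gauss_deriv i j k t x\<bar> \<le>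
    (\<Sum>a\<le>k. \<bar>gauss_coeff (axial_degree i j) k a\<bar> * norm x ^ (2 * a + 2 - k) * (t ^ a * exp (- t * (norm x)\<^sup>2)))"
proof -
  let ?b = "axial_degree i j" and ?E = "\<lambda>a. t ^ a * exp (- t * (norm x)\<^sup>2)"
  have "\<bar>transverse_factor i j x * (gauss_coeff ?b k a * (x $ j) ^ (2 * a + ?b - k) * ?E a)\<bar> \<le>
    \<bar>gauss_coeff ?b k a\<bar> * norm x ^ (2 * a + 2 - k) * ?E a" for a
  proof (cases "2 * a + ?b < k")
    case True
    then show ?thesis by (simp add: gauss_coeff_below)
  next
    case False
    have "\<bar>transverse_factor i j x\<bar> \<le> norm x ^ (2 - ?b)"
      using power_mono[OF component_le_norm_cart[of x i], of 2]
      by (auto simp: transverse_factor_def axial_degree_def)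
    moreover have "\<bar>x $ j\<bar> ^ (2 * a + ?b - k) \<le> norm x ^ (2 * a + ?b - k)"
      by (intro power_mono component_le_norm_cart) auto
    ultimately have "\<bar>transverse_factor i j x\<bar> * \<bar>x $ j\<bar> ^ (2 * a + ?b - k) \<le>
        norm x ^ (2 - ?b) * norm x ^ (2 * a + ?b - k)"
      by (intro mult_mono) auto
    also have "\<dots> = norm x ^ (2 * a + 2 - k)"
      using False by (auto simp: axial_degree_def simp flip: power_add split: if_splits intro!: arg_cong[where f = "power _"])
    finally have "\<bar>gauss_coeff ?b k a\<bar> * (\<bar>transverse_factor i j x\<bar> * \<bar>x $ j\<bar> ^ (2 * a + ?b - k)) * ?E a \<le>
        \<bar>gauss_coeff ?b k a\<bar> * norm x ^ (2 * a + 2 - k) * ?E a"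
      using assms by (intro mult_right_mono mult_left_mono) auto
    then show ?thesis
      using assms by (simp add: abs_mult power_abs mult_ac)
  qed
  then show ?thesis
    unfolding gauss_deriv_def gauss_sum_def sum_distrib_left
    by (intro order_trans[OF sum_abs] sum_mono) auto
qed

section \<open>The symbol as a superposition of Gaussians\<close>

text \<open>
  Up to normalization the integrand is the density of an Erlang distribution.
\<close>

lemma has_bochner_integral_power_exp:
  fixes q :: real
  assumes q: "0 < q"
  shows "has_bochner_integral lborel (\<lambda>t. indicator {0<..} t * (t ^ a * exp (- t * q))) (fact a / q ^ Suc a)"
proof -
  \<comment> \<open>The two sides may differ at \<open>t = 0\<close>, where the Erlang density need not vanish.\<close>
  have e: "indicator {0<..} t * (t ^ a * exp (- t * q)) = erlang_density a q t * (fact a / q ^ Suc a)"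
    if "t \<noteq> 0" for t :: real
    using q that by (auto simp: erlang_density_def indicator_def field_simps)
  have "has_bochner_integral lborel (erlang_density a q) 1"
    using nn_integral_erlang_ith_moment[OF q, of a 0]
    by (intro has_bochner_integral_nn_integral) (auto simp: erlang_density_def q less_imp_le)
  then have "has_bochner_integral lborel (\<lambda>t. erlang_density a q t * (fact a / q ^ Suc a)) (1 * (fact a / q ^ Suc a))"
    by (intro has_bochner_integral_mult_left)
  then show ?thesis
    by (subst has_bochner_integral_cong_AE[where g = "\<lambda>t. erlang_density a q t * (fact a / q ^ Suc a)"])
      (use AE_lborel_singleton[of "0::real"] e in \<open>auto elim: eventually_mono\<close>)
qed

text \<open>
  The symbol and all its derivatives are superpositions of Gaussians. For \<open>k = 0\<close> this is the
  identity \<open>1/|x|\<^sup>2 = \<integral>\<^sub>0\<^sup>\<infinity> exp (-t |x|\<^sup>2) dt\<close>; for larger \<open>k\<close> the two sides agree term by term.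
\<close>

lemma has_bochner_integral_gauss_deriv:
  fixes x :: "real^'n::finite"
  assumes "x \<noteq> 0"
  shows "has_bochner_integral lborel (\<lambda>t. indicator {0<..} t * gauss_deriv i j k t x) (riesz_deriv i j k x)"
proof -
  let ?c = "\<lambda>a. transverse_factor i j x * (gauss_coeff (axial_degree i j) k a * (x $ j) ^ (2 * a + axial_degree i j - k))"
  have "has_bochner_integral lborel
    (\<lambda>t. \<Sum>a\<le>k. ?c a * (indicator {0<..} t * (t ^ a * exp (- t * (norm x)\<^sup>2))))
    (\<Sum>a\<le>k. ?c a * (fact a / ((norm x)\<^sup>2) ^ Suc a))"
    by (intro has_bochner_integral_sum has_bochner_integral_mult_right has_bochner_integral_power_exp)
      (use assms in auto)
  then show ?thesis
    by (simp add: gauss_deriv_def riesz_deriv_def gauss_sum_def sum_distrib_left mult_ac)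
qed

text \<open>
  The constant \<open>C\<close> in \<open>\<integral>\<^sub>0\<^sup>\<infinity> |\<partial>\<^sub>j\<^sup>k g\<^sub>t(x)| dt \<le> C |x|\<^sup>-\<^sup>k\<close>.
\<close>

definition gauss_bound :: "nat \<Rightarrow> nat \<Rightarrow> real" where
  "gauss_bound b k = (\<Sum>a\<le>k. \<bar>gauss_coeff b k a\<bar> * fact a)"

lemma nn_integral_abs_gauss_deriv_le:
  fixes x :: "real^'n::finite"
  assumes "x \<noteq> 0"
  shows "(\<integral>\<^sup>+ t. ennreal (indicator {0<..} t * \<bar>gauss_deriv i j k t x\<bar>) \<partial>lborel) \<le>
    ennreal (gauss_bound (axial_degree i j) k / norm x ^ k)"
proof -
  let ?c = "\<lambda>a. \<bar>gauss_coeff (axial_degree i j) k a\<bar>"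
  let ?F = "\<lambda>t. \<Sum>a\<le>k. ?c a * norm x ^ (2 * a + 2 - k) * (indicator {0<..} t * (t ^ a * exp (- t * (norm x)\<^sup>2)))"
  have F: "has_bochner_integral lborel ?F (\<Sum>a\<le>k. ?c a * norm x ^ (2 * a + 2 - k) * (fact a / ((norm x)\<^sup>2) ^ Suc a))"
    by (intro has_bochner_integral_sum has_bochner_integral_mult_right has_bochner_integral_power_exp)
      (use assms in auto)
  have F0: "0 \<le> ?F t" for t
    by (cases "0 < t") (auto intro!: sum_nonneg mult_nonneg_nonneg)
  have "(\<integral>\<^sup>+ t. ennreal (indicator {0<..} t * \<bar>gauss_deriv i j k t x\<bar>) \<partial>lborel) \<le> (\<integral>\<^sup>+ t. ennreal (?F t) \<partial>lborel)"
  proof (intro nn_integral_mono ennreal_leI)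
    fix t
    show "indicator {0<..} t * \<bar>gauss_deriv i j k t x\<bar> \<le> ?F t"
      using abs_gauss_deriv_le[of t i j k x] by (simp add: indicator_def)
  qed
  also have "\<dots> = ennreal (\<Sum>a\<le>k. ?c a * norm x ^ (2 * a + 2 - k) * (fact a / ((norm x)\<^sup>2) ^ Suc a))"
    using F F0 by (subst nn_integral_eq_integral) (auto simp: has_bochner_integral_iff)
  also have "(\<Sum>a\<le>k. ?c a * norm x ^ (2 * a + 2 - k) * (fact a / ((norm x)\<^sup>2) ^ Suc a)) =
    gauss_bound (axial_degree i j) k / norm x ^ k"
    unfolding gauss_bound_def sum_divide_distrib
  proof (rule sum.cong[OF refl])
    fix a
    show "?c a * norm x ^ (2 * a + 2 - k) * (fact a / ((norm x)\<^sup>2) ^ Suc a) = ?c a * fact a / norm x ^ k"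
    proof (cases "2 * a + axial_degree i j < k")
      case True
      then show ?thesis by (simp add: gauss_coeff_below)
    next
      case False
      then have "k \<le> 2 * a + 2"
        by (auto simp: axial_degree_def split: if_splits)
      then have "((norm x)\<^sup>2) ^ Suc a = norm x ^ (2 * a + 2 - k) * norm x ^ k"
        by (simp add: power_mult[symmetric] power_add[symmetric])
      then show ?thesis
        using assms by simp
    qed
  qed
  finally show ?thesis .
qed

lemma continuous_on_gauss_deriv:
  "continuous_on UNIV (\<lambda>p. gauss_deriv i j k (fst p) (snd p) :: real)"
  unfolding gauss_deriv_def gauss_sum_def transverse_factor_def
  by (cases "i = j") (auto intro!: continuous_intros)

lemma borel_measurable_gauss_deriv:
  assumes f: "f \<in> M \<rightarrow>\<^sub>M borel" and g: "g \<in> M \<rightarrow>\<^sub>M borel"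
  shows "(\<lambda>x. gauss_deriv i j k (f x) (g x)) \<in> borel_measurable M"
proof -
  have "(\<lambda>x. (f x, g x)) \<in> M \<rightarrow>\<^sub>M borel"
    using measurable_Pair[OF f g] by (simp add: borel_prod)
  from measurable_compose[OF this borel_measurable_continuous_onI[OF continuous_on_gauss_deriv]]
  show ?thesis by simp
qed

text \<open>
  The exchange of the integral over \<open>t\<close> with an integral over space. The measure \<open>\<mu>\<close> is Lebesgue
  measure or surface measure, and \<open>v\<close> collects the remaining factors of the integrand. After
  \<open>nn_integral_abs_gauss_deriv_le\<close>, absolute convergence is the finiteness of \<open>\<integral>|v| / |x|\<^sup>k d\<mu>\<close>.
\<close>

lemma
  fixes \<mu> :: "(real^'n::finite) measure" and v :: "real^'n \<Rightarrow> complex"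
  assumes sf: "sigma_finite_measure \<mu>" and id: "(\<lambda>x. x) \<in> \<mu> \<rightarrow>\<^sub>M borel"
    and v: "v \<in> borel_measurable borel" and nz: "AE x in \<mu>. x \<noteq> 0"
    and fin: "(\<integral>\<^sup>+ x. ennreal (norm (v x) / norm x ^ k) \<partial>\<mu>) < \<infinity>"
  shows integrable_integral_gauss_deriv:
      "integrable lborel (\<lambda>t. indicator {0<..} t *\<^sub>R (\<integral>x. gauss_deriv i j k t x *\<^sub>R v x \<partial>\<mu>))" (is ?th1)
    and integral_integral_gauss_deriv:
      "(\<integral>t. indicator {0<..} t *\<^sub>R (\<integral>x. gauss_deriv i j k t x *\<^sub>R v x \<partial>\<mu>) \<partial>lborel) =
        (\<integral>x. riesz_deriv i j k x *\<^sub>R v x \<partial>\<mu>)" (is ?th2)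
proof -
  interpret sigma_finite_measure \<mu> by (rule sf)
  interpret P: pair_sigma_finite lborel \<mu> ..
  define f where "f t x = (indicator {0<..} t * gauss_deriv i j k t x) *\<^sub>R v x" for t x
  let ?B = "gauss_bound (axial_degree i j) k"
  have B0: "0 \<le> ?B"
    by (simp add: gauss_bound_def sum_nonneg)
  have id2: "snd \<in> lborel \<Otimes>\<^sub>M \<mu> \<rightarrow>\<^sub>M borel"
    by (rule measurable_compose[OF measurable_snd id])
  have v': "v \<in> borel_measurable \<mu>"
    using measurable_compose[OF id v] by simp
  have gm: "(\<lambda>p. gauss_deriv i j k (fst p) (snd p)) \<in> borel_measurable (lborel \<Otimes>\<^sub>M \<mu>)"
    by (rule borel_measurable_gauss_deriv[OF _ id2]) simp
  have fm: "case_prod f \<in> borel_measurable (lborel \<Otimes>\<^sub>M \<mu>)"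
    unfolding f_def split_beta'
    by (intro borel_measurable_scaleR borel_measurable_times gm measurable_compose[OF id2 v]) measurable
  have fn: "(\<lambda>p. ennreal (norm (case_prod f p))) \<in> borel_measurable (lborel \<Otimes>\<^sub>M \<mu>)"
    by (rule measurable_compose[OF fm]) measurable
  have "(\<lambda>x. norm x) \<in> borel_measurable \<mu>"
    by (rule measurable_compose[OF id]) simp
  then have vm: "(\<lambda>x. ennreal (norm (v x) / norm x ^ k)) \<in> borel_measurable \<mu>"
    using v' by simp
  have int: "integrable (lborel \<Otimes>\<^sub>M \<mu>) (case_prod f)"
  proof (rule integrableI_bounded[OF fm])
    have "(\<integral>\<^sup>+ p. ennreal (norm (case_prod f p)) \<partial>(lborel \<Otimes>\<^sub>M \<mu>)) =
      (\<integral>\<^sup>+ x. \<integral>\<^sup>+ t. ennreal (norm (f t x)) \<partial>lborel \<partial>\<mu>)"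
      by (subst P.nn_integral_snd[symmetric]) (use fn in \<open>auto simp: split_beta'\<close>)
    also have "\<dots> \<le> (\<integral>\<^sup>+ x. ennreal ?B * ennreal (norm (v x) / norm x ^ k) \<partial>\<mu>)"
    proof (rule nn_integral_mono_AE)
      show "AE x in \<mu>. (\<integral>\<^sup>+ t. ennreal (norm (f t x)) \<partial>lborel) \<le> ennreal ?B * ennreal (norm (v x) / norm x ^ k)"
        using nz
      proof eventually_elim
        case (elim x)
        have "(\<integral>\<^sup>+ t. ennreal (norm (f t x)) \<partial>lborel) =
          (\<integral>\<^sup>+ t. ennreal (norm (v x)) * ennreal (indicator {0<..} t * \<bar>gauss_deriv i j k t x\<bar>) \<partial>lborel)"
          by (intro nn_integral_cong) (auto simp: f_def abs_mult mult_ac simp flip: ennreal_mult)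
        also have "\<dots> = ennreal (norm (v x)) * (\<integral>\<^sup>+ t. ennreal (indicator {0<..} t * \<bar>gauss_deriv i j k t x\<bar>) \<partial>lborel)"
          by (intro nn_integral_cmult measurable_compose[OF _ measurable_ennreal] borel_measurable_times
            borel_measurable_abs borel_measurable_gauss_deriv) auto
        also have "\<dots> \<le> ennreal (norm (v x)) * ennreal (?B / norm x ^ k)"
          by (intro mult_left_mono nn_integral_abs_gauss_deriv_le elim) auto
        also have "\<dots> = ennreal ?B * ennreal (norm (v x) / norm x ^ k)"
          using B0 by (simp add: mult_ac flip: ennreal_mult)
        finally show ?case .
      qed
    qed
    also have "\<dots> = ennreal ?B * (\<integral>\<^sup>+ x. ennreal (norm (v x) / norm x ^ k) \<partial>\<mu>)"
      by (rule nn_integral_cmult[OF vm])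
    also have "\<dots> < \<infinity>"
      using fin by (simp add: ennreal_mult_less_top)
    finally show "(\<integral>\<^sup>+ p. ennreal (norm (case_prod f p)) \<partial>(lborel \<Otimes>\<^sub>M \<mu>)) < \<infinity>" .
  qed
  have inner: "(\<integral>x. f t x \<partial>\<mu>) = indicator {0<..} t *\<^sub>R (\<integral>x. gauss_deriv i j k t x *\<^sub>R v x \<partial>\<mu>)" for t
    by (simp add: f_def flip: scaleR_scaleR)
  show ?th1
    using P.integrable_fst'[OF int] by (simp add: inner)
  have ft: "(\<integral>t. f t x \<partial>lborel) = riesz_deriv i j k x *\<^sub>R v x" if "x \<noteq> 0" for x
    using has_bochner_integral_scaleR_left[OF has_bochner_integral_gauss_deriv[OF that, of i j k], of "v x"]
    by (simp add: f_def has_bochner_integral_iff)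
  have rm: "riesz_deriv i j k \<in> borel_measurable borel"
    unfolding riesz_deriv_def gauss_sum_def transverse_factor_def
    by (cases "i = j") (auto intro!: borel_measurable_sum borel_measurable_times borel_measurable_power
       borel_measurable_continuous_onI[OF continuous_on_component] borel_measurable_divide)
  have "(\<lambda>x. riesz_deriv i j k x *\<^sub>R v x) \<in> borel_measurable \<mu>"
    by (intro borel_measurable_scaleR measurable_compose[OF id rm] measurable_compose[OF id v])
  then show ?th2
    unfolding inner[symmetric] P.Fubini_integral[OF int, symmetric]
    by (intro integral_cong_AE) (use nz ft P.integrable_snd[OF int] in \<open>auto elim: eventually_mono\<close>)
qed

section \<open>Fourier transforms of Gaussians\<close>

lemma exp_neg_sqr_eq_normal_density:
  assumes "0 < (t::real)"
  shows "exp (- t * s\<^sup>2) = sqrt (pi / t) * normal_density 0 (1 / sqrt (2 * t)) s"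
  using assms by (auto simp: normal_density_def power_divide real_sqrt_divide power_mult_distrib)

lemma integrable_exp_neg_sqr:
  assumes "0 < (t::real)"
  shows "integrable lborel (\<lambda>s. exp (- t * s\<^sup>2))"
  unfolding exp_neg_sqr_eq_normal_density[OF assms]
  using assms by (intro integrable_mult_right integrable_normal_density) auto

lemma exp_neg_norm_sqr_prod:
  fixes x :: "'a::euclidean_space"
  shows "exp (- t * (norm x)\<^sup>2) = (\<Prod>b\<in>Basis. exp (- t * (x \<bullet> b)\<^sup>2))"
  unfolding power2_norm_eq_inner euclidean_inner[of x x]
  by (simp add: exp_sum[symmetric] sum_distrib_left sum_negf power2_eq_square)

lemma integrable_exp_neg_norm_sqr:
  assumes t: "0 < t"
  shows "integrable lborel (\<lambda>x::'a::euclidean_space. exp (- t * (norm x)\<^sup>2))"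
proof (rule integrableI_bounded)
  have "(\<integral>\<^sup>+ x. ennreal (norm (exp (- t * (norm x)\<^sup>2))) \<partial>(lborel :: 'a measure)) =
      (\<integral>\<^sup>+ x. (\<Prod>b\<in>Basis. ennreal (exp (- t * (x \<bullet> b)\<^sup>2))) \<partial>(lborel :: 'a measure))"
    unfolding exp_neg_norm_sqr_prod by (simp add: prod_ennreal prod_nonneg)
  also have "\<dots> = (\<Prod>b\<in>(Basis::'a set). (\<integral>\<^sup>+ s. ennreal (exp (- t * s\<^sup>2)) \<partial>lborel))"
    by (rule nn_integral_lborel_prod) auto
  also have "\<dots> < \<infinity>"
    using integrable_exp_neg_sqr[OF t]
    by (simp add: integrable_iff_bounded power_less_top_ennreal)
  finally show "(\<integral>\<^sup>+ x. ennreal (norm (exp (- t * (norm x)\<^sup>2))) \<partial>(lborel :: 'a measure)) < \<infinity>" .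
qed auto

text \<open>
  Half of the Gaussian absorbs the power: \<open>u\<^sup>n \<le> exp (n u)\<close>, and completing the square gives
  \<open>n u \<le> n\<^sup>2/(2t) + (t/2) u\<^sup>2\<close>.
\<close>

lemma integrable_norm_power_gaussian:
  assumes t: "0 < t"
  shows "integrable lborel (\<lambda>x::'a::euclidean_space. norm x ^ n * exp (- t * (norm x)\<^sup>2))"
proof (rule Bochner_Integration.integrable_bound)
  show "integrable lborel (\<lambda>x::'a. exp (n\<^sup>2 / (2 * t)) * exp (- (t / 2) * (norm x)\<^sup>2))"
    by (intro integrable_mult_right integrable_exp_neg_norm_sqr) (use t in auto)
  have "u ^ n * exp (- t * u\<^sup>2) \<le> exp (n\<^sup>2 / (2 * t)) * exp (- (t / 2) * u\<^sup>2)" if "0 \<le> u" for u :: real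
  proof -
    have "u \<le> exp u"
      using exp_ge_add_one_self[of u] by linarith
    then have "u ^ n \<le> exp u ^ n"
      using that by (rule power_mono)
    also have "\<dots> = exp (n * u)"
      by (simp add: exp_of_nat_mult)
    finally have "u ^ n * exp (- t * u\<^sup>2) \<le> exp (n * u) * exp (- t * u\<^sup>2)"
      by (rule mult_right_mono) simp
    also have "\<dots> = exp (n * u + - t * u\<^sup>2)"
      by (rule exp_add[symmetric])
    also have "exp (n * u + - t * u\<^sup>2) \<le> exp (n\<^sup>2 / (2 * t) + - (t / 2) * u\<^sup>2)"
    proof -
      have "0 \<le> (t / 2) * (u - n / t)\<^sup>2"
        using t by simp
      also have "\<dots> = (t / 2) * u\<^sup>2 - n * u + n\<^sup>2 / (2 * t)"
        using t by (simp add: power2_diff power_divide field_simps power2_eq_square)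
      finally show ?thesis by simp
    qed
    finally show ?thesis by (simp only: exp_add)
  qed
  from this[OF norm_ge_zero]
  show "AE x in lborel. norm (norm (x::'a) ^ n * exp (- t * (norm x)\<^sup>2)) \<le>
     norm (exp (n\<^sup>2 / (2 * t)) * exp (- (t / 2) * (norm x)\<^sup>2))"
    by (auto simp: abs_mult)
qed auto

lemma lborel_integral_prod:
  fixes f :: "'a::euclidean_space \<Rightarrow> real \<Rightarrow> complex"
  assumes f: "\<And>b. b \<in> Basis \<Longrightarrow> integrable lborel (f b)"
  shows "(\<integral>x. (\<Prod>b\<in>Basis. f b (x \<bullet> b)) \<partial>lborel) = (\<Prod>b\<in>Basis. integral\<^sup>L lborel (f b))"
proof -
  interpret product_sigma_finite "\<lambda>_::'a. interval_measure (\<lambda>x. x)"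
    by (simp add: product_sigma_finite_def sigma_finite_interval_measure)
  have [measurable]: "f b \<in> borel_measurable borel" if "b \<in> Basis" for b
    using f[OF that] by auto
  have "(\<integral>x. (\<Prod>b\<in>Basis. f b (x \<bullet> b)) \<partial>lborel) =
     (\<integral>g. (\<Prod>b\<in>Basis. f b ((\<Sum>c\<in>Basis. g c *\<^sub>R c) \<bullet> b)) \<partial>(\<Pi>\<^sub>M b\<in>Basis. interval_measure (\<lambda>x. x)))"
    unfolding lborel_def[where 'a = 'a] by (rule integral_distr) measurable
  also have "\<dots> = (\<integral>g. (\<Prod>b\<in>Basis. f b (g b)) \<partial>(\<Pi>\<^sub>M b\<in>Basis. interval_measure (\<lambda>x. x)))"
    by simp
  also have "\<dots> = (\<Prod>b\<in>Basis. integral\<^sup>L lborel (f b))"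
    unfolding lborel_eq_real by (rule product_integral_prod) (use f in \<open>auto simp: lborel_eq_real\<close>)
  finally show ?thesis .
qed

text \<open>
  The characteristic function of the standard normal distribution, rescaled by \<open>\<surd>(2t)\<close>.
\<close>

lemma integral_gaussian_iexp_real:
  assumes t: "0 < t"
  shows "(\<integral>s. exp (- t * s\<^sup>2) *\<^sub>R iexp (y * s) \<partial>lborel) = complex_of_real (sqrt (pi / t) * exp (- (y\<^sup>2) / (4 * t)))"
proof -
  define r where "r = sqrt (2 * t)"
  have r: "0 < r" "r\<^sup>2 = 2 * t"
    using t by (auto simp: r_def)
  have "(\<integral>x. std_normal_density x *\<^sub>R iexp (y / r * x) \<partial>lborel) = exp (- ((y / r)\<^sup>2) / 2)"
    using fun_cong[OF char_std_normal_distribution, of "y / r"] unfolding char_def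
    by (subst (asm) integral_density) auto
  then have 1: "(\<integral>x. std_normal_density x *\<^sub>R iexp (y / r * x) \<partial>lborel) = exp (- (y\<^sup>2) / (4 * t))"
    using r by (simp add: power_divide)
  have "(\<integral>s. exp (- t * s\<^sup>2) *\<^sub>R iexp (y * s) \<partial>lborel) =
    \<bar>1 / r\<bar> *\<^sub>R (\<integral>x. exp (- t * (0 + 1 / r * x)\<^sup>2) *\<^sub>R iexp (y * (0 + 1 / r * x)) \<partial>lborel)"
    by (rule lborel_integral_real_affine) (use r in auto)
  also have "(\<lambda>x. exp (- t * (0 + 1 / r * x)\<^sup>2) *\<^sub>R iexp (y * (0 + 1 / r * x))) =
    (\<lambda>x. sqrt (2 * pi) *\<^sub>R (std_normal_density x *\<^sub>R iexp (y / r * x)))"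
  proof
    fix x
    have "- t * (0 + 1 / r * x)\<^sup>2 = - x\<^sup>2 / 2"
      using r t by (simp add: power_divide field_simps)
    moreover have "sqrt (2 * pi) * std_normal_density x = exp (- x\<^sup>2 / 2)"
      by (simp add: std_normal_density_def)
    ultimately show "exp (- t * (0 + 1 / r * x)\<^sup>2) *\<^sub>R iexp (y * (0 + 1 / r * x)) =
      sqrt (2 * pi) *\<^sub>R (std_normal_density x *\<^sub>R iexp (y / r * x))"
      by (simp add: scaleR_conv_of_real flip: mult.assoc of_real_mult)
  qed
  also have "\<bar>1 / r\<bar> *\<^sub>R (\<integral>x. sqrt (2 * pi) *\<^sub>R (std_normal_density x *\<^sub>R iexp (y / r * x)) \<partial>lborel) =
    complex_of_real (sqrt (2 * pi) / r * exp (- (y\<^sup>2) / (4 * t)))"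
    unfolding integral_scaleR_right 1 using r by (simp add: scaleR_conv_of_real)
  also have "sqrt (2 * pi) / r = sqrt (pi / t)"
    by (simp add: r_def real_sqrt_divide real_sqrt_mult)
  finally show ?thesis .
qed

lemma integral_gaussian_iexp:
  fixes y :: "'a::euclidean_space"
  assumes t: "0 < t"
  shows "(\<integral>x. exp (- t * (norm x)\<^sup>2) *\<^sub>R iexp (y \<bullet> x) \<partial>lborel) =
    complex_of_real (sqrt (pi / t) ^ DIM('a) * exp (- (norm y)\<^sup>2 / (4 * t)))"
proof -
  have iexp_prod: "iexp (y \<bullet> x) = (\<Prod>b\<in>Basis. iexp ((y \<bullet> b) * (x \<bullet> b)))" for x
    by (subst euclidean_inner[of y x]) (simp add: exp_sum sum_distrib_left)
  have "(\<integral>x. exp (- t * (norm x)\<^sup>2) *\<^sub>R iexp (y \<bullet> x) \<partial>(lborel :: 'a measure)) =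
    (\<integral>x. (\<Prod>b\<in>Basis. exp (- t * (x \<bullet> b)\<^sup>2) *\<^sub>R iexp ((y \<bullet> b) * (x \<bullet> b))) \<partial>lborel)"
    unfolding exp_neg_norm_sqr_prod iexp_prod by (simp add: scaleR_conv_of_real prod.distrib)
  also have "\<dots> = (\<Prod>b\<in>Basis. (\<integral>s. exp (- t * s\<^sup>2) *\<^sub>R iexp ((y \<bullet> b) * s) \<partial>lborel))"
  proof (rule lborel_integral_prod)
    fix b
    show "integrable lborel (\<lambda>s. exp (- t * s\<^sup>2) *\<^sub>R iexp ((y \<bullet> b) * s))"
      by (rule Bochner_Integration.integrable_bound[OF integrable_exp_neg_sqr[OF t]]) auto
  qed
  also have "\<dots> = (\<Prod>b\<in>Basis. complex_of_real (sqrt (pi / t) * exp (- ((y \<bullet> b)\<^sup>2) / (4 * t))))"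
    by (simp only: integral_gaussian_iexp_real[OF t])
  also have "\<dots> = complex_of_real (sqrt (pi / t) ^ DIM('a) * exp (- (norm y)\<^sup>2 / (4 * t)))"
    using exp_neg_norm_sqr_prod[of "1 / (4 * t)" y]
    by (simp add: prod.distrib flip: of_real_prod)
  finally show ?thesis .
qed

lemma has_vector_derivative_iexp_line:
  fixes x y :: "real^'n::finite"
  shows "((\<lambda>s. iexp (y \<bullet> (x + s *\<^sub>R axis i 1))) has_vector_derivative
    (\<i> * (y $ i)) * iexp (y \<bullet> (x + s *\<^sub>R axis i 1))) (at s)"
proof -
  have eq: "iexp (y \<bullet> (x + s *\<^sub>R axis i 1)) = exp (\<i> * (of_real (y \<bullet> x) + of_real s * of_real (y $ i)))" for s
    by (simp add: inner_add_right inner_axis)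
  show ?thesis
    unfolding eq
    by (rule has_vector_derivative_real_field[where f = "\<lambda>z. exp (\<i> * (of_real (y \<bullet> x) + z * of_real (y $ i)))"])
      (auto intro!: derivative_eq_intros)
qed

text \<open>
  Let \<open>E\<close> be the Gaussian times the exponential and \<open>M\<^sub>n = \<integral>x\<^sub>i\<^sup>n E\<close>. The derivatives of \<open>E\<close> and of
  \<open>x\<^sub>i E\<close> in direction \<open>i\<close> have integral \<open>0\<close>, that is, \<open>-2t M\<^sub>1 + i y\<^sub>i M\<^sub>0 = 0\<close> and
  \<open>M\<^sub>0 - 2t M\<^sub>2 + i y\<^sub>i M\<^sub>1 = 0\<close> (the factor \<open>i\<close> in front of \<open>y\<^sub>i\<close> being the imaginary unit). These
  equations express \<open>M\<^sub>2\<close> in terms of \<open>M\<^sub>0\<close>, so no differentiation in the parameter \<open>y\<close> is needed.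
\<close>

lemma integral_gaussian_sqr_iexp:
  fixes y :: "real^'n::finite"
  assumes t: "0 < t"
  shows "(\<integral>x. ((x $ i)\<^sup>2 * exp (- t * (norm x)\<^sup>2)) *\<^sub>R iexp (y \<bullet> x) \<partial>lborel) =
    complex_of_real (sqrt (pi / t) ^ CARD('n) * (1 / (2 * t) - (y $ i)\<^sup>2 / (4 * t\<^sup>2)) * exp (- (norm y)\<^sup>2 / (4 * t)))"
proof -
  define E where "E x = exp (- t * (norm x)\<^sup>2) *\<^sub>R iexp (y \<bullet> x)" for x :: "real^'n"
  define M where "M n = (\<integral>x. (x $ i) ^ n *\<^sub>R E x \<partial>lborel)" for n
  have cE: "continuous_on A E" for A
    unfolding E_def by (intro continuous_intros)
  have int: "integrable lborel (\<lambda>x. (x $ i) ^ n *\<^sub>R E x)" for n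
  proof (rule Bochner_Integration.integrable_bound[OF integrable_norm_power_gaussian[OF t, of n]])
    show "AE x in lborel. norm ((x $ i) ^ n *\<^sub>R E x) \<le> norm (norm x ^ n * exp (- t * (norm x)\<^sup>2))"
      by (auto simp: E_def norm_mult power_abs abs_mult intro!: AE_I2 mult_right_mono power_mono component_le_norm_cart)
    show "(\<lambda>x. (x $ i) ^ n *\<^sub>R E x) \<in> borel_measurable lborel"
      using borel_measurable_continuous_onI[of "\<lambda>x. (x $ i) ^ n *\<^sub>R E x"]
      by (simp add: continuous_intros cE)
  qed
  have i1: "integrable lborel (\<lambda>x. c *\<^sub>R ((x $ i) ^ n *\<^sub>R E x))"
    and i2: "integrable lborel (\<lambda>x. d * ((x $ i) ^ n *\<^sub>R E x))" for c d n
    by (intro Bochner_Integration.integrable_scaleR_right integrable_mult_right int)+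
  have dn: "((\<lambda>s. (norm (x + s *\<^sub>R axis i 1 :: real^'n))\<^sup>2) has_real_derivative 2 * (x $ i + s)) (at s)" for x s
    unfolding power2_norm_eq_inner
    by (auto intro!: derivative_eq_intros simp: inner_simps inner_axis inner_axis_axis inner_commute[of "axis i 1"])
  have dE: "((\<lambda>s. E (x + s *\<^sub>R axis i 1)) has_vector_derivative
    (- 2 * t * (x + s *\<^sub>R axis i 1) $ i) *\<^sub>R E (x + s *\<^sub>R axis i 1) + (\<i> * (y $ i)) * E (x + s *\<^sub>R axis i 1)) (at s)"
    for x s
  proof -
    have 1: "((\<lambda>s. exp (- t * (norm (x + s *\<^sub>R axis i 1))\<^sup>2)) has_real_derivative
      (- 2 * t * (x $ i + s)) * exp (- t * (norm (x + s *\<^sub>R axis i 1))\<^sup>2)) (at s)"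
      using DERIV_chain2[OF DERIV_exp DERIV_cmult[OF dn[of x s], of "- t"]] by (simp add: mult_ac)
    note 2 = has_vector_derivative_iexp_line[of y x i s]
    show ?thesis
      unfolding E_def
      by (rule has_vector_derivative_eq_rhs[OF has_vector_derivative_scaleR[OF 1 2]])
        (simp add: axis_nth algebra_simps)
  qed
  have c1: "continuous_on {0..1} (\<lambda>s. (x + s *\<^sub>R axis i 1 :: real^'n) $ i)" for x
    by (intro continuous_intros)
  have cl: "continuous_on {0..1} (\<lambda>s. E (x + s *\<^sub>R axis i 1))" for x
    by (intro continuous_on_compose2[OF cE[of UNIV]] continuous_intros) auto
  have "(\<integral>x. (- 2 * t * x $ i) *\<^sub>R E x + (\<i> * (y $ i)) * E x \<partial>lborel) = 0"
    by (rule integral_directional_derivative_eq_0[of E _ "axis i 1" "{}"])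
      (use int[of 0] int[of 1] cl dE in \<open>auto simp flip: scaleR_scaleR\<close>)
  moreover have "(\<integral>x. (- 2 * t * x $ i) *\<^sub>R E x + (\<i> * (y $ i)) * E x \<partial>lborel) =
    (\<integral>x. (- 2 * t) *\<^sub>R ((x $ i) ^ 1 *\<^sub>R E x) + (\<i> * (y $ i)) * ((x $ i) ^ 0 *\<^sub>R E x) \<partial>lborel)"
    by (simp add: mult.assoc)
  moreover have "\<dots> = (- 2 * t) *\<^sub>R M 1 + (\<i> * (y $ i)) * M 0"
    unfolding M_def
    by (simp only: Bochner_Integration.integral_add[OF i1 i2] integral_scaleR_right integral_mult_right_zero)
  ultimately have M1: "(- 2 * t) *\<^sub>R M 1 + (\<i> * (y $ i)) * M 0 = 0"
    by simp
  have "(\<integral>x. E x + (x $ i) *\<^sub>R ((- 2 * t * x $ i) *\<^sub>R E x + (\<i> * (y $ i)) * E x) \<partial>lborel) = 0"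
  proof (rule integral_directional_derivative_eq_0[of "\<lambda>x. x $ i *\<^sub>R E x" _ "axis i 1" "{}"])
    have "integrable lborel (\<lambda>x. (x $ i) ^ 0 *\<^sub>R E x + (- 2 * t) *\<^sub>R ((x $ i) ^ 2 *\<^sub>R E x) +
        (\<i> * (y $ i)) * ((x $ i) ^ 1 *\<^sub>R E x))"
      by (intro Bochner_Integration.integrable_add int i1 i2)
    then show "integrable lborel (\<lambda>x. E x + (x $ i) *\<^sub>R ((- 2 * t * x $ i) *\<^sub>R E x + (\<i> * (y $ i)) * E x))"
      by (simp add: algebra_simps power2_eq_square)
    show "((\<lambda>s. (x + s *\<^sub>R axis i 1) $ i *\<^sub>R E (x + s *\<^sub>R axis i 1)) has_vector_derivative
      E (x + s *\<^sub>R axis i 1) + (x + s *\<^sub>R axis i 1) $ i *\<^sub>R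
       ((- 2 * t * (x + s *\<^sub>R axis i 1) $ i) *\<^sub>R E (x + s *\<^sub>R axis i 1) + (\<i> * (y $ i)) * E (x + s *\<^sub>R axis i 1))) (at s)"
      for x s
    proof -
      have "((\<lambda>s. (x + s *\<^sub>R axis i 1) $ i) has_real_derivative 1) (at s)"
        by (auto intro!: derivative_eq_intros simp: axis_nth)
      from has_vector_derivative_scaleR[OF this dE] show ?thesis
        by (simp add: add.commute)
    qed
    show "continuous_on {0..1} (\<lambda>s. (x + s *\<^sub>R axis i 1) $ i *\<^sub>R E (x + s *\<^sub>R axis i 1))" for x
      by (intro continuous_on_scaleR c1 cl)
  qed (use int[of 1] in auto)
  moreover have "(\<integral>x. E x + (x $ i) *\<^sub>R ((- 2 * t * x $ i) *\<^sub>R E x + (\<i> * (y $ i)) * E x) \<partial>lborel) =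
    (\<integral>x. (x $ i) ^ 0 *\<^sub>R E x + ((- 2 * t) *\<^sub>R ((x $ i) ^ 2 *\<^sub>R E x) + (\<i> * (y $ i)) * ((x $ i) ^ 1 *\<^sub>R E x)) \<partial>lborel)"
    by (simp add: algebra_simps power2_eq_square)
  moreover have "\<dots> = M 0 + ((- 2 * t) *\<^sub>R M 2 + (\<i> * (y $ i)) * M 1)"
    unfolding M_def
    by (simp only: Bochner_Integration.integral_add[OF int Bochner_Integration.integrable_add[OF i1 i2]]
        Bochner_Integration.integral_add[OF i1 i2] integral_scaleR_right integral_mult_right_zero)
  ultimately have M2: "M 0 + ((- 2 * t) *\<^sub>R M 2 + (\<i> * (y $ i)) * M 1) = 0"
    by simp
  have M0: "M 0 = complex_of_real (sqrt (pi / t) ^ CARD('n) * exp (- (norm y)\<^sup>2 / (4 * t)))"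
    using integral_gaussian_iexp[OF t, of y] by (simp add: M_def E_def scaleR_conv_of_real)
  have t': "complex_of_real t \<noteq> 0"
    using t by simp
  have M1': "M 1 = \<i> * (y $ i) / (2 * t) * M 0"
    using M1 t' by (simp add: scaleR_conv_of_real field_simps)
  have "M 2 = (M 0 + \<i> * (y $ i) * M 1) / (2 * t)"
    using M2 t' by (simp add: scaleR_conv_of_real field_simps)
  also have "\<dots> = complex_of_real (1 / (2 * t) - (y $ i)\<^sup>2 / (4 * t\<^sup>2)) * M 0"
    unfolding M1' using t' by (simp add: field_simps power2_eq_square)
  finally show ?thesis
    unfolding M0 by (simp add: M_def E_def mult_ac)
qed

section \<open>Convergence of the weights\<close>

lemma nn_integral_inverse_power_atLeast:
  assumes "0 < (u::real)" "0 < a"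
  shows "(\<integral>\<^sup>+ r. ennreal (a / r ^ Suc a) * indicator {u..} r \<partial>lborel) = ennreal (1 / u ^ a)"
proof -
  have "(\<integral>\<^sup>+ r. ennreal (a / r ^ Suc a) * indicator {u..} r \<partial>lborel) = ennreal (0 - (- 1 / u ^ a))"
  proof (rule nn_integral_FTC_atLeast)
    show "((\<lambda>r. - 1 / r ^ a) has_real_derivative real a / r ^ Suc a) (at r)" if "u \<le> r" for r
    proof -
      have "r \<noteq> 0"
        using that assms by simp
      have "((\<lambda>r. - inverse (r ^ a)) has_real_derivative - (- (inverse (r ^ a) * (a * r ^ (a - 1)) * inverse (r ^ a)))) (at r)"
        by (intro derivative_eq_intros DERIV_inverse' refl | use \<open>r \<noteq> 0\<close> in simp)+
      also have "- (- (inverse (r ^ a) * (a * r ^ (a - 1)) * inverse (r ^ a))) = real a / r ^ Suc a"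
        using \<open>r \<noteq> 0\<close> assms by (cases a) (auto simp: field_simps)
      finally show ?thesis
        by (simp add: divide_inverse)
    qed
    show "((\<lambda>r::real. - 1 / r ^ a) \<longlongrightarrow> 0) at_top"
      using tendsto_minus[OF tendsto_inverse_0_at_top[OF filterlim_pow_at_top[OF assms(2) filterlim_ident]]]
      by (simp only: inverse_eq_divide minus_divide_left minus_zero)
  qed (use assms in auto)
  then show ?thesis by simp
qed

text \<open>
  The layer-cake formula: \<open>|x|\<^sup>-\<^sup>a\<close> is the integral of \<open>a r\<^bsup>-a-1\<^esup>\<close> over \<open>r \<ge> |x|\<close>, so by Tonelli only the
  growth of the volume of \<open>U\<close> in balls matters. The minimum in the hypothesis makes the resulting
  integral over \<open>r\<close> converge both at \<open>0\<close> and at infinity.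
\<close>

lemma nn_integral_inverse_norm_power_finite:
  fixes U :: "'a::euclidean_space set"
  assumes U [measurable]: "U \<in> sets borel" and a: "0 < a" and C: "0 \<le> C"
    and vol: "\<And>r. 0 < r \<Longrightarrow> emeasure lborel (U \<inter> cball 0 r) \<le> ennreal (C * r ^ Suc a * min 1 (1 / r\<^sup>2))"
  shows "(\<integral>\<^sup>+ x. ennreal (indicator U x / norm x ^ a) \<partial>lborel) < \<infinity>"
proof -
  have "(\<integral>\<^sup>+ x. ennreal (indicator U x / norm x ^ a) \<partial>lborel) =
    (\<integral>\<^sup>+ x. \<integral>\<^sup>+ r. indicator U x * (ennreal (a / r ^ Suc a) * indicator {norm x..} r) \<partial>lborel \<partial>lborel)"
  proof (rule nn_integral_cong_AE)
    show "AE x in lborel. ennreal (indicator U x / norm x ^ a) =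
      (\<integral>\<^sup>+ r. indicator U x * (ennreal (a / r ^ Suc a) * indicator {norm x..} r) \<partial>lborel)"
      using AE_lborel_singleton[of 0]
    proof eventually_elim
      case (elim x)
      then show ?case
        using nn_integral_inverse_power_atLeast[OF _ a, of "norm x"]
        by (subst nn_integral_cmult) (auto simp: indicator_def)
    qed
  qed
  also have "\<dots> = (\<integral>\<^sup>+ r. \<integral>\<^sup>+ x. indicator U x * (ennreal (a / r ^ Suc a) * indicator {norm x..} r) \<partial>lborel \<partial>lborel)"
    by (rule lborel_pair.Fubini') (auto simp: atLeast_def intro!: measurable_If)
  also have "\<dots> \<le> (\<integral>\<^sup>+ r. ennreal (a * C) * (indicator {0..1} r + ennreal (1 / r\<^sup>2) * indicator {1..} r) \<partial>lborel)"
  proof (rule nn_integral_mono_AE)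
    show "AE r in lborel. (\<integral>\<^sup>+ x. indicator U x * (ennreal (a / r ^ Suc a) * indicator {norm x..} r) \<partial>lborel) \<le>
       ennreal (a * C) * (indicator {0..1} r + ennreal (1 / r\<^sup>2) * indicator {1..} r)"
      using AE_lborel_singleton[of 0]
    proof eventually_elim
      case (elim r)
      have "(\<integral>\<^sup>+ x. indicator U x * (ennreal (a / r ^ Suc a) * indicator {norm x..} r) \<partial>lborel) =
        (\<integral>\<^sup>+ x. ennreal (a / r ^ Suc a) * indicator (U \<inter> cball 0 r) x \<partial>lborel)"
        by (intro nn_integral_cong) (auto simp: indicator_def)
      also have "\<dots> = ennreal (a / r ^ Suc a) * emeasure lborel (U \<inter> cball 0 r)"
        by (rule nn_integral_cmult_indicator) auto
      also have "\<dots> \<le> ennreal (a * C) * (indicator {0..1} r + ennreal (1 / r\<^sup>2) * indicator {1..} r)"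
      proof (cases "0 < r")
        case True
        have "ennreal (a / r ^ Suc a) * emeasure lborel (U \<inter> cball 0 r) \<le>
           ennreal (a / r ^ Suc a) * ennreal (C * r ^ Suc a * min 1 (1 / r\<^sup>2))"
          by (intro mult_left_mono vol True) auto
        also have "\<dots> = ennreal (a / r ^ Suc a * (C * r ^ Suc a * min 1 (1 / r\<^sup>2)))"
          by (rule ennreal_mult[symmetric]) (use True C in auto)
        also have "a / r ^ Suc a * (C * r ^ Suc a * min 1 (1 / r\<^sup>2)) = (a * C) * min 1 (1 / r\<^sup>2)"
          using True by simp
        also have "ennreal ((a * C) * min 1 (1 / r\<^sup>2)) = ennreal (a * C) * ennreal (min 1 (1 / r\<^sup>2))"
          by (rule ennreal_mult) (use C in auto)
        also have "\<dots> \<le> ennreal (a * C) * (indicator {0..1} r + ennreal (1 / r\<^sup>2) * indicator {1..} r)"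
          using True by (intro mult_left_mono) (cases "r \<le> 1", auto simp: indicator_def intro!: ennreal_leI order_trans[OF ennreal_leI[OF min.cobounded1]] add_increasing2)
        finally show ?thesis .
      next
        case False
        then have "cball (0::'a) r = {}"
          using elim by auto
        then show ?thesis by simp
      qed
      finally show ?case .
    qed
  qed
  also have "\<dots> = ennreal (a * C) * ((\<integral>\<^sup>+ r. indicator {0..1::real} r \<partial>lborel) +
       (\<integral>\<^sup>+ r. ennreal (1 / r\<^sup>2) * indicator {1..} r \<partial>lborel))"
    by (subst nn_integral_cmult, measurable, subst nn_integral_add) auto
  also have "(\<integral>\<^sup>+ r. ennreal (1 / r\<^sup>2) * indicator {1..} r \<partial>lborel) = 1"
    using nn_integral_inverse_power_atLeast[of 1 1] by (simp add: power2_eq_square)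
  also have "ennreal (a * C) * ((\<integral>\<^sup>+ r. indicator {0..1::real} r \<partial>lborel) + 1) < \<infinity>"
    by (simp add: ennreal_mult_less_top)
  finally show ?thesis .
qed

lemma emeasure_cball_eq:
  "0 \<le> r \<Longrightarrow> emeasure lborel (cball (0::'a::euclidean_space) r) = ennreal (unit_ball_vol (real DIM('a)) * r ^ DIM('a))"
  by (simp add: emeasure_cball)

lemma nn_integral_outside_ball_finite:
  "(\<integral>\<^sup>+ x. ennreal (indicator (- ball 0 1) x / norm x ^ Suc DIM('a)) \<partial>(lborel :: 'a::euclidean_space measure)) < \<infinity>"
proof (rule nn_integral_inverse_norm_power_finite)
  let ?V = "unit_ball_vol (real DIM('a))"
  show "emeasure lborel (- ball 0 1 \<inter> cball (0::'a) r) \<le> ennreal (?V * r ^ Suc (Suc DIM('a)) * min 1 (1 / r\<^sup>2))"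
    if r: "0 < r" for r
  proof (cases "r < 1")
    case True
    then have "- ball 0 1 \<inter> cball (0::'a) r = {}"
      by auto
    then show ?thesis by (simp only: emeasure_empty zero_le)
  next
    case False
    then have "1 / r\<^sup>2 \<le> 1"
      using one_le_power[of r 2] by simp
    then have "min 1 (1 / r\<^sup>2) = 1 / r\<^sup>2"
      by (rule min_absorb2)
    then have eq: "?V * r ^ Suc (Suc DIM('a)) * min 1 (1 / r\<^sup>2) = ?V * r ^ DIM('a)"
      using r by (simp add: power2_eq_square)
    have "emeasure lborel (- ball 0 1 \<inter> cball (0::'a) r) \<le> emeasure lborel (cball (0::'a) r)"
      by (intro emeasure_mono) auto
    then show ?thesis
      unfolding eq using r by (simp add: emeasure_cball_eq)
  qed
qed auto

lemma nn_integral_inside_ball_finite: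
  assumes "2 \<le> DIM('a::euclidean_space)"
  shows "(\<integral>\<^sup>+ x. ennreal (indicator (ball 0 1) x / norm x ^ (DIM('a) - 1)) \<partial>(lborel :: 'a measure)) < \<infinity>"
proof (rule nn_integral_inverse_norm_power_finite)
  let ?V = "unit_ball_vol (real DIM('a))"
  show "emeasure lborel (ball 0 1 \<inter> cball (0::'a) r) \<le> ennreal (?V * r ^ Suc (DIM('a) - 1) * min 1 (1 / r\<^sup>2))"
    if r: "0 < r" for r
  proof (cases "r \<le> 1")
    case True
    then have "min 1 (1 / r\<^sup>2) = 1"
      using r by (simp add: min_def le_divide_eq power_le_one)
    moreover have "emeasure lborel (ball 0 1 \<inter> cball (0::'a) r) \<le> emeasure lborel (cball (0::'a) r)"
      by (intro emeasure_mono) auto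
    ultimately show ?thesis
      using r by (simp add: emeasure_cball_eq)
  next
    case False
    then have "1 / r\<^sup>2 \<le> 1"
      using one_le_power[of r 2] by simp
    then have "min 1 (1 / r\<^sup>2) = 1 / r\<^sup>2"
      by (rule min_absorb2)
    moreover have "r ^ DIM('a) = r ^ (DIM('a) - 2) * r\<^sup>2"
      using assms by (metis le_add_diff_inverse2 power_add)
    moreover have "1 \<le> r ^ (DIM('a) - 2)"
      using False by (simp add: one_le_power)
    ultimately have V: "?V \<le> ?V * r ^ Suc (DIM('a) - 1) * min 1 (1 / r\<^sup>2)"
      using r unit_ball_vol_nonneg[of "real DIM('a)"] by (simp add: mult_le_cancel_left1 not_less[symmetric])
    have "emeasure lborel (ball 0 1 \<inter> cball (0::'a) r) \<le> emeasure lborel (cball (0::'a) 1)"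
      by (intro emeasure_mono) auto
    also have "\<dots> = ennreal ?V"
      using emeasure_cball_eq[of 1, where 'a = 'a] by simp
    also have "\<dots> \<le> ennreal (?V * r ^ Suc (DIM('a) - 1) * min 1 (1 / r\<^sup>2))"
      using V by (rule ennreal_leI)
    finally show ?thesis .
  qed
qed (use assms in auto)

section \<open>The integral over the Gaussian parameter\<close>

lemma has_integral_Gamma_greaterThan:
  assumes "0 < (x::real)"
  shows "((\<lambda>t. t powr (x - 1) * exp (- t)) has_integral Gamma x) {0<..}"
proof -
  have "((\<lambda>t. t powr (x - 1) / exp t) has_integral Gamma x) {0<..}"
    using Gamma_integral_real[OF assms]
    by (subst has_integral_spike_set_eq[of _ "{0..}"]) (auto intro: negligible_subset[of "{0}"])
  then show ?thesis
    by (simp add: exp_minus divide_inverse)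
qed

text \<open>
  The substitution \<open>t = 1/(4s)\<close> turns the integrand into
  \<open>(4\<pi>)\<^bsup>N/2\<^esup> (s\<^bsup>N/2 - 1\<^esup>/2 - c s\<^bsup>N/2\<^esup>) exp (-s)\<close>, whose integral consists of two values of the Gamma function.
\<close>

lemma integral_gaussian_profile:
  fixes c :: real and N :: nat
  assumes N: "0 < N"
  shows "(\<integral>t. indicator {0<..} t * (sqrt (pi / t) ^ N * (1 / (2 * t) - c / (4 * t\<^sup>2)) * exp (- 1 / (4 * t))) \<partial>lborel) =
    (4 * pi) powr (N / 2) * (Gamma (N / 2) / 2 * (1 - N * c))"
proof -
  define f where "f t = sqrt (pi / t) ^ N * (1 / (2 * t) - c / (4 * t\<^sup>2)) * exp (- 1 / (4 * t))" for t
  define g where "g s = 1 / (4 * s)" for s :: real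
  define h where "h s = (4 * pi) powr (N / 2) * (s powr (N / 2 - 1) * exp (- s) / 2 - c * (s powr (N / 2 + 1 - 1) * exp (- s)))" for s
  have G: "((\<lambda>s. s powr (N / 2 - 1) * exp (- s)) has_integral Gamma (N / 2)) {0<..}"
    "((\<lambda>s. s powr (N / 2 + 1 - 1) * exp (- s)) has_integral Gamma (N / 2 + 1)) {0<..}"
    using N by (intro has_integral_Gamma_greaterThan; simp)+
  have absG: "(\<lambda>s. s powr (N / 2 - 1) * exp (- s)) absolutely_integrable_on {0<..}"
    "(\<lambda>s. s powr (N / 2 + 1 - 1) * exp (- s)) absolutely_integrable_on {0<..}"
    using G by (auto intro!: nonnegative_absolutely_integrable_1 has_integral_integrable)
  have "(h has_integral (4 * pi) powr (N / 2) * (Gamma (N / 2) / 2 - c * Gamma (N / 2 + 1))) {0<..}"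
    unfolding h_def by (intro has_integral_mult_right has_integral_diff has_integral_divide G)
  moreover have "Gamma (N / 2 + 1) = N / 2 * Gamma (N / 2 :: real)"
    using N by (intro Gamma_plus1) (auto simp: nonpos_Ints_def)
  moreover have "Gamma (N / 2) / 2 - c * (N / 2 * Gamma (N / 2 :: real)) = Gamma (N / 2) / 2 * (1 - N * c)"
    by (simp add: algebra_simps)
  ultimately have h_int: "(h has_integral (4 * pi) powr (N / 2) * (Gamma (N / 2) / 2 * (1 - N * c))) {0<..}"
    by (simp only:)
  have h_abs: "h absolutely_integrable_on {0<..}"
    unfolding h_def
    by (intro set_integrable_mult_right set_integral_diff set_integrable_divide absG)
  have eq: "\<bar>- 1 / (4 * s\<^sup>2)\<bar> * f (g s) = h s" if s: "0 < s" for s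
  proof -
    have "sqrt (pi / g s) ^ N = (4 * pi * s) powr (N / 2)"
      using s by (simp add: g_def powr_half_sqrt[symmetric] powr_powr flip: powr_realpow) (simp add: mult_ac)
    also have "\<dots> = (4 * pi) powr (N / 2) * s powr (N / 2)"
      using s by (simp add: powr_mult)
    finally have 1: "sqrt (pi / g s) ^ N = (4 * pi) powr (N / 2) * s powr (N / 2)" .
    have 2: "1 / (2 * g s) - c / (4 * (g s)\<^sup>2) = 2 * s - 4 * c * s\<^sup>2" "- 1 / (4 * g s) = - s"
      using s by (simp_all add: g_def field_simps power2_eq_square)
    have 3: "s powr (N / 2 - 1) = s powr (N / 2) / s"
      using s by (simp add: powr_diff)
    show ?thesis
      unfolding f_def h_def 1 2 3 using s by (simp add: abs_if field_simps power2_eq_square)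
  qed
  have img: "g ` {0<..} = {0<..}"
  proof -
    have "x \<in> g ` {0<..}" if "0 < x" for x
      using that by (intro image_eqI[of _ _ "1 / (4 * x)"]) (auto simp: g_def)
    then show ?thesis by (auto simp: g_def)
  qed
  have "f absolutely_integrable_on (g ` {0<..}) \<and>
      integral (g ` {0<..}) f = (4 * pi) powr (N / 2) * (Gamma (N / 2) / 2 * (1 - N * c))"
  proof (rule has_absolute_integral_change_of_variables_1'[THEN iffD1])
    show "(g has_field_derivative - 1 / (4 * s\<^sup>2)) (at s within {0<..})" if "s \<in> {0<..}" for s
      unfolding g_def using that by (auto intro!: derivative_eq_intros simp: field_simps power2_eq_square)
    show "inj_on g {0<..}"
      by (auto simp: inj_on_def g_def)
    have "(\<lambda>s. \<bar>- 1 / (4 * s\<^sup>2)\<bar> * f (g s)) absolutely_integrable_on {0<..} \<longleftrightarrow> h absolutely_integrable_on {0<..}"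
      by (rule set_integrable_cong[OF refl refl eq]) simp
    moreover have "integral {0<..} (\<lambda>s. \<bar>- 1 / (4 * s\<^sup>2)\<bar> * f (g s)) = integral {0<..} h"
      by (rule Henstock_Kurzweil_Integration.integral_cong[OF eq]) simp
    ultimately show "(\<lambda>s. \<bar>- 1 / (4 * s\<^sup>2)\<bar> * f (g s)) absolutely_integrable_on {0<..} \<and>
      integral {0<..} (\<lambda>s. \<bar>- 1 / (4 * s\<^sup>2)\<bar> * f (g s)) = (4 * pi) powr (N / 2) * (Gamma (N / 2) / 2 * (1 - N * c))"
      using h_abs integral_unique[OF h_int] by (simp only:)
  qed auto
  then have f: "f absolutely_integrable_on {0<..}" "integral {0<..} f = (4 * pi) powr (N / 2) * (Gamma (N / 2) / 2 * (1 - N * c))"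
    unfolding img by auto
  have "(\<integral>t. indicator {0<..} t * f t \<partial>lborel) = (\<integral>t. indicator {0<..} t * f t \<partial>lebesgue)"
    by (rule integral_completion[symmetric]) (simp add: f_def)
  also have "\<dots> = integral {0<..} f"
    using set_lebesgue_integral_eq_integral(2)[OF f(1)] by (simp add: set_lebesgue_integral_def)
  finally show ?thesis
    using f(2) by (simp add: f_def)
qed

section \<open>The boundary terms\<close>

lemma integrable_gauss_deriv:
  fixes i j :: "'n::finite"
  assumes t: "0 < t"
  shows "integrable lborel (gauss_deriv i j k t :: real^'n \<Rightarrow> real)"
proof (rule Bochner_Integration.integrable_bound)
  show "integrable lborel (\<lambda>x::real^'n. \<Sum>a\<le>k. (\<bar>gauss_coeff (axial_degree i j) k a\<bar> * t ^ a) *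
      (norm x ^ (2 * a + 2 - k) * exp (- t * (norm x)\<^sup>2)))"
    by (intro Bochner_Integration.integrable_sum integrable_mult_right integrable_norm_power_gaussian t)
  show "(gauss_deriv i j k t :: real^'n \<Rightarrow> real) \<in> borel_measurable lborel"
    by (intro borel_measurable_gauss_deriv) auto
  show "AE x in lborel. norm (gauss_deriv i j k t x) \<le>
    norm (\<Sum>a\<le>k. (\<bar>gauss_coeff (axial_degree i j) k a\<bar> * t ^ a) *
      (norm x ^ (2 * a + 2 - k) * exp (- t * (norm x)\<^sup>2)))"
  proof (rule AE_I2)
    fix x :: "real^'n"
    show "norm (gauss_deriv i j k t x) \<le> norm (\<Sum>a\<le>k. (\<bar>gauss_coeff (axial_degree i j) k a\<bar> * t ^ a) *
      (norm x ^ (2 * a + 2 - k) * exp (- t * (norm x)\<^sup>2)))"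
      using abs_gauss_deriv_le[of t i j k x] t by (simp add: mult_ac)
  qed
qed

lemma integrable_gauss_deriv_wave:
  fixes \<sigma> :: "real^'n::finite"
  assumes t: "0 < t"
  shows "integrable lborel (\<lambda>x. gauss_deriv i j k t x *\<^sub>R iexp (\<sigma> \<bullet> x))"
  by (rule Bochner_Integration.integrable_bound[OF integrable_gauss_deriv[OF t, of i j k]])
    (auto intro!: borel_measurable_scaleR borel_measurable_gauss_deriv)

lemma continuous_on_gauss_deriv_space:
  "continuous_on A (\<lambda>x. gauss_deriv i j k t x)"
  by (rule continuous_on_compose2[OF continuous_on_gauss_deriv, of A "\<lambda>x. (t, x)", simplified])
    (intro continuous_intros)

text \<open>
  The derivative in direction \<open>j\<close> of \<open>\<partial>\<^sub>j\<^sup>k g\<^sub>t(x) exp (i\<sigma>\<cdot>x)\<close>, see \<open>has_vector_derivative_wave\<close>.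
\<close>

definition wave_deriv :: "'n::finite \<Rightarrow> 'n \<Rightarrow> nat \<Rightarrow> real \<Rightarrow> real^'n \<Rightarrow> real^'n \<Rightarrow> complex" where
  "wave_deriv i j k t \<sigma> x = gauss_deriv i j (Suc k) t x *\<^sub>R iexp (\<sigma> \<bullet> x) +
     (\<i> * complex_of_real (\<sigma> $ j)) * (gauss_deriv i j k t x *\<^sub>R iexp (\<sigma> \<bullet> x))"

lemma has_vector_derivative_wave:
  "((\<lambda>s. gauss_deriv i j k t (x + s *\<^sub>R axis j 1) *\<^sub>R iexp (\<sigma> \<bullet> (x + s *\<^sub>R axis j 1))) has_vector_derivative
    wave_deriv i j k t \<sigma> (x + s *\<^sub>R axis j 1)) (at s)"
  by (rule has_vector_derivative_eq_rhs[OF has_vector_derivative_scaleR[OF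
        has_real_derivative_gauss_deriv has_vector_derivative_iexp_line]])
    (simp add: wave_deriv_def)

lemma integrable_wave_deriv: "0 < t \<Longrightarrow> integrable lborel (wave_deriv i j k t \<sigma>)"
  unfolding wave_deriv_def
  by (intro Bochner_Integration.integrable_add integrable_mult_right integrable_gauss_deriv_wave)

lemma continuous_on_wave: "continuous_on A (\<lambda>x. gauss_deriv i j k t x *\<^sub>R iexp (\<sigma> \<bullet> x))"
  by (intro continuous_intros continuous_on_gauss_deriv_space)

lemma continuous_on_wave_deriv: "continuous_on A (wave_deriv i j k t \<sigma>)"
  unfolding wave_deriv_def by (intro continuous_intros continuous_on_gauss_deriv_space)

lemma integral_wave_deriv_eq_0:
  assumes t: "0 < t"
  shows "integral\<^sup>L lborel (wave_deriv i j k t \<sigma>) = 0"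
proof (rule integral_directional_derivative_eq_0[OF integrable_gauss_deriv_wave[OF t] integrable_wave_deriv[OF t],
      where e = "axis j 1" and E = "{}"])
  show "continuous_on {0..1} (\<lambda>s. gauss_deriv i j k t (x + s *\<^sub>R axis j 1) *\<^sub>R
      iexp (\<sigma> \<bullet> (x + s *\<^sub>R axis j 1)))" for x
    by (rule continuous_on_compose2[OF continuous_on_wave[of UNIV]]) (auto intro!: continuous_intros)
qed (auto intro: has_vector_derivative_wave)

lemma integral_gauss_deriv_wave:
  assumes t: "0 < t"
  shows "(\<integral>x. gauss_deriv i j k t x *\<^sub>R iexp (\<sigma> \<bullet> x) \<partial>lborel) =
    (- \<i> * complex_of_real (\<sigma> $ j)) ^ k * (\<integral>x. gauss_deriv i j 0 t x *\<^sub>R iexp (\<sigma> \<bullet> x) \<partial>lborel)"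
proof (induction k)
  case (Suc k)
  have "(\<integral>x. gauss_deriv i j (Suc k) t x *\<^sub>R iexp (\<sigma> \<bullet> x) \<partial>lborel) +
     (\<i> * complex_of_real (\<sigma> $ j)) * (\<integral>x. gauss_deriv i j k t x *\<^sub>R iexp (\<sigma> \<bullet> x) \<partial>lborel) = 0"
    using integral_wave_deriv_eq_0[OF t, of i j k \<sigma>] unfolding wave_deriv_def
    by (simp only: Bochner_Integration.integral_add[OF integrable_gauss_deriv_wave[OF t]
          integrable_mult_right[OF integrable_gauss_deriv_wave[OF t]]] integral_mult_right_zero)
  then show ?case
    unfolding Suc by (simp add: eq_neg_iff_add_eq_0 mult_ac)
qed simp

text \<open>
  Integration by parts read backwards, for a rapidly decreasing function in place of the symbol.
  On the complement of the ball, the divergence theorem shows that the first two terms together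
  are the integral of \<open>\<partial>\<^sub>j\<^sup>N g\<^sub>t exp (i\<sigma>\<cdot>x)\<close> over the complement. On the ball, the third term is the integral
  of \<open>\<partial>\<^sub>j\<^sup>N g\<^sub>t\<close>, which compensates the subtracted \<open>1\<close> in the fourth term.
\<close>

lemma regularized_boundary_terms:
  fixes \<sigma> :: "real^'n::finite"
  assumes t: "0 < t" and \<sigma>: "\<sigma> $ j \<noteq> 0" and N: "0 < N"
  shows "\<i> / complex_of_real (\<sigma> $ j) * (\<integral>x. gauss_deriv i j (N + 1) t x *\<^sub>R (indicator (- ball 0 1) x *\<^sub>R iexp (\<sigma> \<bullet> x)) \<partial>lborel)
    + \<i> / complex_of_real (\<sigma> $ j) * (\<integral>x. gauss_deriv i j N t x *\<^sub>R (x $ j *\<^sub>R iexp (\<sigma> \<bullet> x)) \<partial>sphere_measure)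
    + (\<integral>x. gauss_deriv i j (N - 1) t x *\<^sub>R complex_of_real (x $ j) \<partial>sphere_measure)
    + (\<integral>x. gauss_deriv i j N t x *\<^sub>R (indicator (ball 0 1) x *\<^sub>R (iexp (\<sigma> \<bullet> x) - 1)) \<partial>lborel)
    = (\<integral>x. gauss_deriv i j N t x *\<^sub>R iexp (\<sigma> \<bullet> x) \<partial>lborel)"
    (is "?c * ?P + ?c * ?S1 + ?S2 + ?R = ?T")
proof -
  define F where "F k x = gauss_deriv i j k t x *\<^sub>R iexp (\<sigma> \<bullet> x)" for k x
  define I where "I A f = (\<integral>x. indicator A x *\<^sub>R f x \<partial>lborel)" for A :: "(real^'n) set" and f :: "real^'n \<Rightarrow> complex"
  let ?B = "ball (0::real^'n) 1" and ?a = "\<i> * complex_of_real (\<sigma> $ j)"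
  have intF: "integrable lborel (F k)" for k
    unfolding F_def by (rule integrable_gauss_deriv_wave[OF t])
  have intG: "integrable lborel (\<lambda>x. complex_of_real (gauss_deriv i j k t x))" for k
    by (rule integrable_of_real[OF integrable_gauss_deriv[OF t]])
  have intA: "integrable lborel (\<lambda>x. indicator A x *\<^sub>R f x)" if "A \<in> sets borel" "integrable lborel f"
    for A and f :: "real^'n \<Rightarrow> complex"
    using that by (intro integrable_mult_indicator) auto
  have split: "I ?B f + I (- ?B) f = integral\<^sup>L lborel f" if "integrable lborel f" for f
  proof -
    have "I ?B f + I (- ?B) f = (\<integral>x. indicator ?B x *\<^sub>R f x + indicator (- ?B) x *\<^sub>R f x \<partial>lborel)"
      unfolding I_def by (rule Bochner_Integration.integral_add[symmetric]) (auto intro!: intA that)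
    also have "(\<lambda>x. indicator ?B x *\<^sub>R f x + indicator (- ?B) x *\<^sub>R f x) = f"
      by (auto simp: indicator_def)
    finally show ?thesis .
  qed
  have W: "I A (wave_deriv i j N t \<sigma>) = I A (F (Suc N)) + ?a * I A (F N)" if "A \<in> sets borel" for A
  proof -
    have "I A (wave_deriv i j N t \<sigma>) = (\<integral>x. indicator A x *\<^sub>R F (Suc N) x + ?a * (indicator A x *\<^sub>R F N x) \<partial>lborel)"
      unfolding I_def by (rule Bochner_Integration.integral_cong) (auto simp: wave_deriv_def F_def indicator_def)
    also have "\<dots> = I A (F (Suc N)) + ?a * I A (F N)"
      unfolding I_def
      by (simp only: Bochner_Integration.integral_add[OF intA[OF that intF] integrable_mult_right[OF intA[OF that intF]]]
          integral_mult_right_zero)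
    finally show ?thesis .
  qed
  have axis: "x \<bullet> axis j 1 = x $ j" for x :: "real^'n"
    by (simp add: inner_axis)
  have ax0: "axis j 1 \<noteq> (0 :: real^'n)"
    by (simp add: axis_eq_0_iff)
  have S1: "?S1 = I ?B (wave_deriv i j N t \<sigma>)"
    using divergence_ball[OF continuous_on_wave continuous_on_wave_deriv has_vector_derivative_wave ax0, of i N t \<sigma>]
    by (simp add: I_def axis mult_ac)
  have P: "?P = I (- ?B) (F (Suc N))"
    unfolding I_def F_def by (rule Bochner_Integration.integral_cong) (auto simp: mult_ac)
  have "(?P + ?S1) + ?a * I (- ?B) (F N) = I ?B (wave_deriv i j N t \<sigma>) + I (- ?B) (wave_deriv i j N t \<sigma>)"
    unfolding S1 P by (subst W) (auto simp: add_ac)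
  also have "\<dots> = 0"
    using split[OF integrable_wave_deriv[OF t, of i j N \<sigma>]] integral_wave_deriv_eq_0[OF t, of i j N \<sigma>] by simp
  finally have "?P + ?S1 = - ?a * I (- ?B) (F N)"
    by (simp add: eq_neg_iff_add_eq_0)
  then have "?c * ?P + ?c * ?S1 = ?c * (- ?a * I (- ?B) (F N))"
    by (simp only: distrib_left[symmetric])
  also have "\<dots> = I (- ?B) (F N)"
    using \<sigma> by simp
  finally have 1: "?c * ?P + ?c * ?S1 = I (- ?B) (F N)" .
  \<comment> \<open>This is the divergence theorem for \<open>\<partial>\<^sub>j\<^sup>N\<^sup>-\<^sup>1 g\<^sub>t\<close> without the exponential factor.\<close>
  have 2: "?S2 = I ?B (\<lambda>x. complex_of_real (gauss_deriv i j N t x))"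
  proof -
    have N': "N = Suc (N - 1)"
      using N by simp
    have "I ?B (\<lambda>x. complex_of_real (gauss_deriv i j (Suc (N - 1)) t x)) =
      (\<integral>x. (x \<bullet> axis j 1) *\<^sub>R complex_of_real (gauss_deriv i j (N - 1) t x) \<partial>sphere_measure)"
      unfolding I_def
    proof (rule divergence_ball[OF _ _ _ ax0])
      show "((\<lambda>s. complex_of_real (gauss_deriv i j (N - 1) t (x + s *\<^sub>R axis j 1))) has_vector_derivative
        complex_of_real (gauss_deriv i j (Suc (N - 1)) t (x + s *\<^sub>R axis j 1))) (at s)" for x s
        by (rule has_vector_derivative_of_real[OF has_real_derivative_gauss_deriv])
    qed (auto intro!: continuous_intros continuous_on_gauss_deriv_space)
    then show ?thesis
      using N by (simp add: axis scaleR_conv_of_real mult_ac)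
  qed
  have 3: "?R = I ?B (F N) - I ?B (\<lambda>x. complex_of_real (gauss_deriv i j N t x))"
  proof -
    have "?R = (\<integral>x. indicator ?B x *\<^sub>R F N x - indicator ?B x *\<^sub>R complex_of_real (gauss_deriv i j N t x) \<partial>lborel)"
      by (rule Bochner_Integration.integral_cong) (auto simp: F_def indicator_def scaleR_conv_of_real algebra_simps)
    also have "\<dots> = I ?B (F N) - I ?B (\<lambda>x. complex_of_real (gauss_deriv i j N t x))"
      unfolding I_def by (rule Bochner_Integration.integral_diff) (auto intro!: intA intF intG)
    finally show ?thesis .
  qed
  show ?thesis
    using split[OF intF[of N]] unfolding 1 2 3 by (simp add: F_def[abs_def] add.commute)
qed

lemma norm_iexp_diff_1_le: "norm (iexp u - 1) \<le> \<bar>u\<bar>"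
  using iexp_approx1[of u 0] by simp

text \<open>
  Each of the four integrals is written as \<open>\<integral>\<partial>\<^sub>j\<^sup>k m v d\<mu>\<close> with its own order \<open>k\<close>, weight \<open>v\<close> and measure
  \<open>\<mu>\<close>, and is exchanged with the integral over \<open>t\<close>. For fixed \<open>t\<close> the four terms combine by
  \<open>regularized_boundary_terms\<close>.
\<close>

lemma riesz_boundary_terms:
  fixes \<sigma> :: "real^'n::finite"
  assumes N: "N = CARD('n)" "2 \<le> N" and \<sigma>: "norm \<sigma> = 1" "\<sigma> $ j \<noteq> 0"
  shows "\<i> / complex_of_real (\<sigma> $ j) * (\<integral>x. riesz_deriv i j (N + 1) x *\<^sub>R (indicator (- ball 0 1) x *\<^sub>R iexp (\<sigma> \<bullet> x)) \<partial>lborel)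
    + \<i> / complex_of_real (\<sigma> $ j) * (\<integral>x. riesz_deriv i j N x *\<^sub>R (x $ j *\<^sub>R iexp (\<sigma> \<bullet> x)) \<partial>sphere_measure)
    + (\<integral>x. riesz_deriv i j (N - 1) x *\<^sub>R complex_of_real (x $ j) \<partial>sphere_measure)
    + (\<integral>x. riesz_deriv i j N x *\<^sub>R (indicator (ball 0 1) x *\<^sub>R (iexp (\<sigma> \<bullet> x) - 1)) \<partial>lborel)
    = (- \<i> * complex_of_real (\<sigma> $ j)) ^ N *
      complex_of_real ((4 * pi) powr (N / 2) * (Gamma (N / 2) / 2 * (1 - N * (\<sigma> $ i)\<^sup>2)))"
proof -
  let ?B = "ball (0::real^'n) 1" and ?c = "\<i> / complex_of_real (\<sigma> $ j)"
  define v1 where "v1 x = indicator (- ?B) x *\<^sub>R iexp (\<sigma> \<bullet> x)" for x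
  define v2 where "v2 x = x $ j *\<^sub>R iexp (\<sigma> \<bullet> x)" for x
  define v3 where "v3 x = complex_of_real (x $ j)" for x :: "real^'n"
  define v4 where "v4 x = indicator ?B x *\<^sub>R (iexp (\<sigma> \<bullet> x) - 1)" for x
  let ?S = "sphere_measure :: (real^'n) measure"
  have DIM: "DIM(real^'n) = N"
    using N by simp
  have xj: "(\<lambda>x::real^'n. x $ j) \<in> borel_measurable borel"
    by (intro borel_measurable_continuous_onI continuous_intros)
  have v_meas: "v1 \<in> borel_measurable borel" "v2 \<in> borel_measurable borel" "v3 \<in> borel_measurable borel" "v4 \<in> borel_measurable borel"
    unfolding v1_def v2_def v3_def v4_def using xj by (auto intro!: borel_measurable_scaleR borel_measurable_indicator)
  have sfS: "sigma_finite_measure ?S"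
    by (rule finite_measure.axioms(1)[OF finite_measure_sphere_measure])
  have idS: "(\<lambda>x. x) \<in> ?S \<rightarrow>\<^sub>M borel"
    using borel_measurable_sphere_measure[of "\<lambda>x. x"] by simp
  have nzS: "AE x in ?S. x \<noteq> 0"
    by (rule AE_I2) (auto simp: space_sphere_measure)
  have nzL: "AE x in lborel. x \<noteq> (0::real^'n)"
    by (rule AE_lborel_singleton)
  have finS: "(\<integral>\<^sup>+ x. ennreal (norm (v x) / norm x ^ k) \<partial>?S) < \<infinity>"
    if "\<And>x. norm x = 1 \<Longrightarrow> norm (v x) \<le> 1" for v :: "real^'n \<Rightarrow> complex" and k
  proof -
    have "(\<integral>\<^sup>+ x. ennreal (norm (v x) / norm x ^ k) \<partial>?S) \<le> (\<integral>\<^sup>+ x. 1 \<partial>?S)"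
      using that by (intro nn_integral_mono) (auto simp: space_sphere_measure)
    also have "\<dots> < \<infinity>"
      by (simp add: space_sphere_measure emeasure_sphere_measure_sphere)
    finally show ?thesis .
  qed
  have xj1: "\<bar>x $ j\<bar> \<le> 1" if "norm x = 1" for x :: "real^'n"
    using component_le_norm_cart[of x j] that by simp
  have f1: "(\<integral>\<^sup>+ x. ennreal (norm (v1 x) / norm x ^ (N + 1)) \<partial>lborel) < \<infinity>"
  proof -
    have "norm (v1 x) = indicator (- ?B) x" for x
      by (simp add: v1_def)
    then show ?thesis
      using nn_integral_outside_ball_finite[where 'a = "real^'n"] N by simp
  qed
  have f2: "(\<integral>\<^sup>+ x. ennreal (norm (v2 x) / norm x ^ N) \<partial>?S) < \<infinity>"
    by (rule finS) (simp add: v2_def xj1)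
  have f3: "(\<integral>\<^sup>+ x. ennreal (norm (v3 x) / norm x ^ (N - 1)) \<partial>?S) < \<infinity>"
    by (rule finS) (simp add: v3_def xj1)
  have f4: "(\<integral>\<^sup>+ x. ennreal (norm (v4 x) / norm x ^ N) \<partial>lborel) < \<infinity>"
  proof -
    have "norm (v4 x) / norm x ^ N \<le> indicator ?B x / norm x ^ (N - 1)" for x
    proof -
      \<comment> \<open>The cancellation at the origin that makes the order \<open>N\<close> integrable on the ball.\<close>
      have "norm (iexp (\<sigma> \<bullet> x) - 1) \<le> norm x"
        using norm_iexp_diff_1_le[of "\<sigma> \<bullet> x"] Cauchy_Schwarz_ineq2[of \<sigma> x] \<sigma> by simp
      moreover have "norm x ^ N = norm x * norm x ^ (N - 1)"
        using N(2) by (subst power_Suc[symmetric]) simp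
      ultimately show ?thesis
        by (cases "x = 0") (auto simp: v4_def indicator_def field_simps divide_simps)
    qed
    then have "(\<integral>\<^sup>+ x. ennreal (norm (v4 x) / norm x ^ N) \<partial>lborel) \<le>
        (\<integral>\<^sup>+ x. ennreal (indicator ?B x / norm x ^ (N - 1)) \<partial>lborel)"
      by (intro nn_integral_mono ennreal_leI)
    also have "\<dots> < \<infinity>"
      using nn_integral_inside_ball_finite[where 'a = "real^'n"] N by simp
    finally show ?thesis .
  qed
  note A1 = lborel.sigma_finite_measure_axioms measurable_ident_sets[OF sets_lborel] v_meas(1) nzL f1
  note A2 = sfS idS v_meas(2) nzS f2
  note A3 = sfS idS v_meas(3) nzS f3
  note A4 = lborel.sigma_finite_measure_axioms measurable_ident_sets[OF sets_lborel] v_meas(4) nzL f4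
  define J where "J \<mu> k v t = indicator {0<..} t *\<^sub>R (\<integral>x. gauss_deriv i j k t x *\<^sub>R v x \<partial>\<mu>)"
    for \<mu> :: "(real^'n) measure" and k and v :: "real^'n \<Rightarrow> complex" and t
  note int = integrable_integral_gauss_deriv[OF A1, of i j, folded J_def]
     integrable_integral_gauss_deriv[OF A2, of i j, folded J_def]
     integrable_integral_gauss_deriv[OF A3, of i j, folded J_def]
     integrable_integral_gauss_deriv[OF A4, of i j, folded J_def]
  note eq = integral_integral_gauss_deriv[OF A1, of i j, folded J_def]
     integral_integral_gauss_deriv[OF A2, of i j, folded J_def]
     integral_integral_gauss_deriv[OF A3, of i j, folded J_def]
     integral_integral_gauss_deriv[OF A4, of i j, folded J_def]
  have sum: "?c * J lborel (N + 1) v1 t + ?c * J ?S N v2 t + J ?S (N - 1) v3 t + J lborel N v4 t =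
    (- \<i> * complex_of_real (\<sigma> $ j)) ^ N * complex_of_real (indicator {0<..} t *
      (sqrt (pi / t) ^ N * (1 / (2 * t) - (\<sigma> $ i)\<^sup>2 / (4 * t\<^sup>2)) * exp (- 1 / (4 * t))))" for t
  proof (cases "0 < t")
    case True
    have N0: "0 < N"
      using N by simp
    have "?c * J lborel (N + 1) v1 t + ?c * J ?S N v2 t + J ?S (N - 1) v3 t + J lborel N v4 t =
      (\<integral>x. gauss_deriv i j N t x *\<^sub>R iexp (\<sigma> \<bullet> x) \<partial>lborel)"
      using regularized_boundary_terms[OF True \<sigma>(2) N0, of i] True
      unfolding J_def v1_def v2_def v3_def v4_def by simp
    also have "\<dots> = (- \<i> * complex_of_real (\<sigma> $ j)) ^ N * (\<integral>x. gauss_deriv i j 0 t x *\<^sub>R iexp (\<sigma> \<bullet> x) \<partial>lborel)"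
      by (rule integral_gauss_deriv_wave[OF True])
    also have "(\<integral>x. gauss_deriv i j 0 t x *\<^sub>R iexp (\<sigma> \<bullet> x) \<partial>lborel) =
      complex_of_real (sqrt (pi / t) ^ N * (1 / (2 * t) - (\<sigma> $ i)\<^sup>2 / (4 * t\<^sup>2)) * exp (- 1 / (4 * t)))"
      unfolding gauss_deriv_0 integral_gaussian_sqr_iexp[OF True] \<sigma>(1) by (simp add: N(1))
    finally show ?thesis
      using True by simp
  qed (simp add: J_def)
  have "?c * (\<integral>t. J lborel (N + 1) v1 t \<partial>lborel) + ?c * (\<integral>t. J ?S N v2 t \<partial>lborel) +
      (\<integral>t. J ?S (N - 1) v3 t \<partial>lborel) + (\<integral>t. J lborel N v4 t \<partial>lborel) =
    (\<integral>t. ?c * J lborel (N + 1) v1 t + ?c * J ?S N v2 t + J ?S (N - 1) v3 t + J lborel N v4 t \<partial>lborel)"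
    by (simp only: Bochner_Integration.integral_add Bochner_Integration.integrable_add integrable_mult_right
        int integral_mult_right_zero)
  also have "\<dots> = (- \<i> * complex_of_real (\<sigma> $ j)) ^ N * complex_of_real (\<integral>t. indicator {0<..} t *
      (sqrt (pi / t) ^ N * (1 / (2 * t) - (\<sigma> $ i)\<^sup>2 / (4 * t\<^sup>2)) * exp (- 1 / (4 * t))) \<partial>lborel)"
    unfolding sum by (simp only: integral_mult_right_zero integral_complex_of_real)
  also have "(\<integral>t. indicator {0<..} t *
      (sqrt (pi / t) ^ N * (1 / (2 * t) - (\<sigma> $ i)\<^sup>2 / (4 * t\<^sup>2)) * exp (- 1 / (4 * t))) \<partial>lborel) =
      (4 * pi) powr (N / 2) * (Gamma (N / 2) / 2 * (1 - N * (\<sigma> $ i)\<^sup>2))"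
    by (rule integral_gaussian_profile) (use N in simp)
  finally show ?thesis
    unfolding eq unfolding v1_def v2_def v3_def v4_def .
qed

section \<open>The representation formula\<close>

theorem theorem6:
  fixes first j :: "'n::finite" and \<sigma> :: "real^'n" and N :: nat
  assumes "N = CARD('n)" and "N \<ge> 2"
    and "\<sigma> \<in> sphere 0 1" and "\<sigma> $ j \<noteq> 0"
  shows "complex_of_real
      (Gamma (real N / 2) / (2 * pi powr (real N / 2)) * (1 - real N * (\<sigma> $ first)\<^sup>2)) =
    \<i> ^ N / complex_of_real ((2 * pi * \<sigma> $ j) ^ N) *
    ( \<i> / complex_of_real (\<sigma> $ j) *
        (LINT \<xi>:(- ball 0 1)|lborel.
           complex_of_real ((partial_deriv j ^^ (N + 1)) (riesz_hat first) \<xi>) *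
           exp (\<i> * complex_of_real (\<sigma> \<bullet> \<xi>)))
    + \<i> / complex_of_real (\<sigma> $ j) *
        (LINT \<xi>|sphere_measure.
           complex_of_real (\<xi> $ j * (partial_deriv j ^^ N) (riesz_hat first) \<xi>) *
           exp (\<i> * complex_of_real (\<sigma> \<bullet> \<xi>)))
    + (LINT \<xi>|sphere_measure.
           complex_of_real (\<xi> $ j * (partial_deriv j ^^ (N - 1)) (riesz_hat first) \<xi>))
    + (LINT \<xi>:ball 0 1|lborel.
           complex_of_real ((partial_deriv j ^^ N) (riesz_hat first) \<xi>) *
           (exp (\<i> * complex_of_real (\<sigma> \<bullet> \<xi>)) - 1)) )"
proof -
  let ?d = "\<lambda>k. (partial_deriv j ^^ k) (riesz_hat first)" and ?r = "riesz_deriv first j"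
  have d: "?d k x = ?r k x" if "x \<noteq> 0" for k x
    by (rule partial_deriv_iterate_riesz_hat[OF that])
  have e1: "(LINT \<xi>:(- ball 0 1)|lborel. complex_of_real (?d (N + 1) \<xi>) * iexp (\<sigma> \<bullet> \<xi>)) =
      (\<integral>x. ?r (N + 1) x *\<^sub>R (indicator (- ball 0 1) x *\<^sub>R iexp (\<sigma> \<bullet> x)) \<partial>lborel)"
    unfolding set_lebesgue_integral_def
  proof (rule Bochner_Integration.integral_cong[OF refl])
    fix x :: "real^'n"
    show "indicator (- ball 0 1) x *\<^sub>R (complex_of_real (?d (N + 1) x) * iexp (\<sigma> \<bullet> x)) =
      ?r (N + 1) x *\<^sub>R (indicator (- ball 0 1) x *\<^sub>R iexp (\<sigma> \<bullet> x))"
      \<comment> \<open>The origin is not in the complement of the ball, so both sides vanish there.\<close>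
      using d[of x "N + 1"] by (cases "x = 0") (auto simp: scaleR_conv_of_real mult_ac)
  qed
  have e2: "(LINT \<xi>|sphere_measure. complex_of_real (\<xi> $ j * ?d N \<xi>) * iexp (\<sigma> \<bullet> \<xi>)) =
      (\<integral>x. ?r N x *\<^sub>R (x $ j *\<^sub>R iexp (\<sigma> \<bullet> x)) \<partial>sphere_measure)"
  proof (rule Bochner_Integration.integral_cong[OF refl])
    fix x :: "real^'n" assume "x \<in> space sphere_measure"
    then have "x \<noteq> 0"
      by (auto simp: space_sphere_measure)
    then show "complex_of_real (x $ j * ?d N x) * iexp (\<sigma> \<bullet> x) = ?r N x *\<^sub>R (x $ j *\<^sub>R iexp (\<sigma> \<bullet> x))"
      using d[of x N] by (simp add: scaleR_conv_of_real mult_ac)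
  qed
  have e3: "(LINT \<xi>|sphere_measure. complex_of_real (\<xi> $ j * ?d (N - 1) \<xi>)) =
      (\<integral>x. ?r (N - 1) x *\<^sub>R complex_of_real (x $ j) \<partial>sphere_measure)"
  proof (rule Bochner_Integration.integral_cong[OF refl])
    fix x :: "real^'n" assume "x \<in> space sphere_measure"
    then have "x \<noteq> 0"
      by (auto simp: space_sphere_measure)
    then show "complex_of_real (x $ j * ?d (N - 1) x) = ?r (N - 1) x *\<^sub>R complex_of_real (x $ j)"
      using d[of x "N - 1"] by (simp add: scaleR_conv_of_real mult_ac)
  qed
  have e4: "(LINT \<xi>:ball 0 1|lborel. complex_of_real (?d N \<xi>) * (iexp (\<sigma> \<bullet> \<xi>) - 1)) =
      (\<integral>x. ?r N x *\<^sub>R (indicator (ball 0 1) x *\<^sub>R (iexp (\<sigma> \<bullet> x) - 1)) \<partial>lborel)"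
    unfolding set_lebesgue_integral_def
  proof (rule Bochner_Integration.integral_cong[OF refl])
    fix x :: "real^'n"
    show "indicator (ball 0 1) x *\<^sub>R (complex_of_real (?d N x) * (iexp (\<sigma> \<bullet> x) - 1)) =
      ?r N x *\<^sub>R (indicator (ball 0 1) x *\<^sub>R (iexp (\<sigma> \<bullet> x) - 1))"
      \<comment> \<open>At the origin the factor \<open>exp (i\<sigma>\<cdot>x) - 1\<close> vanishes, whatever the value of the derivative there.\<close>
      using d[of x N] by (cases "x = 0") (auto simp: scaleR_conv_of_real mult_ac)
  qed
  define p where "p = pi powr (N / 2)"
  have p: "0 < p"
    by (simp add: p_def)
  have "(2 * pi) ^ N = (2 * pi) powr N"
    by (rule powr_realpow[symmetric]) simp
  also have "\<dots> = ((2 * pi) powr 2) powr (N / 2)"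
    by (simp only: powr_powr) simp
  also have "(2 * pi) powr 2 = (4 * pi) * pi"
    by (simp add: power2_eq_square)
  also have "((4 * pi) * pi) powr (N / 2) = (4 * pi) powr (N / 2) * p"
    unfolding p_def by (rule powr_mult)
  finally have pi_pow: "(4 * pi) powr (N / 2) = (2 * pi) ^ N / p"
    using p by simp
  have \<sigma>: "norm \<sigma> = 1"
    using assms(3) by simp
  have unit: "\<i> ^ N * (- \<i> * complex_of_real (\<sigma> $ j)) ^ N = complex_of_real ((\<sigma> $ j) ^ N)"
    by (simp flip: power_mult_distrib)
  have "\<i> ^ N / complex_of_real ((2 * pi * \<sigma> $ j) ^ N) * ((- \<i> * complex_of_real (\<sigma> $ j)) ^ N *
      complex_of_real ((4 * pi) powr (N / 2) * (Gamma (N / 2) / 2 * (1 - N * (\<sigma> $ first)\<^sup>2)))) =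
    complex_of_real ((\<sigma> $ j) ^ N) * complex_of_real ((4 * pi) powr (N / 2) * (Gamma (N / 2) / 2 * (1 - N * (\<sigma> $ first)\<^sup>2)))
      / complex_of_real ((2 * pi * \<sigma> $ j) ^ N)"
    unfolding unit[symmetric] by (simp only: times_divide_eq_left mult.assoc)
  also have "\<dots> = complex_of_real ((\<sigma> $ j) ^ N * ((2 * pi) ^ N / p * (Gamma (N / 2) / 2 * (1 - N * (\<sigma> $ first)\<^sup>2)))
      / (2 * pi * \<sigma> $ j) ^ N)"
    unfolding pi_pow by (simp only: of_real_mult of_real_divide)
  also have "(\<sigma> $ j) ^ N * ((2 * pi) ^ N / p * (Gamma (N / 2) / 2 * (1 - N * (\<sigma> $ first)\<^sup>2))) / (2 * pi * \<sigma> $ j) ^ N =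
    Gamma (N / 2) / (2 * p) * (1 - N * (\<sigma> $ first)\<^sup>2)"
    using assms(4) p by (simp add: power_mult_distrib)
  finally show ?thesis
    unfolding e1 e2 e3 e4 riesz_boundary_terms[OF assms(1,2) \<sigma> assms(4)] p_def by simp
qed

end
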